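(* The structural rules are admissible in $\mathbf{G3[mic]}^{\{\mathrm{Ref},\mathrm{Rep}_2^l\}}$. Therefore $\mathbf{G3[mic]}^{\{\mathrm{Ref},\mathrm{Rep}\}}$ and $\mathbf{G3[mic]}^{\{\mathrm{Ref},\mathrm{Rep}_2^l\}}$ are equivalent. The same holds for $\mathbf{G3[mic]}^{\{\mathrm{Ref},\mathrm{Rep}_1^l\}}$ in place of $\mathbf{G3[mic]}^{\{\mathrm{Ref},\mathrm{Rep}_2^l\}}$. (Each assertion is for each of $\mathbf{G3m}$, $\mathbf{G3i}$, $\mathbf{G3c}$.)
   Context: Formulas are those of a first-order language with equality (constants and function symbols allowed), with bound variables syntactically distinct from free ones; equalities $t=t'$ are atomic; $\bot$ is not counted as atomic. A sequent $\Gamma\Rightarrow\Delta$ consists of finite multisets $\Gamma,\Delta$ of formulas; comma is multiset union. $F[x/r]$ is the result of replacing all free occurrences of $x$ in $F$ by the term $r$. Logical calculi. $\mathbf{G3c}$ has initial sequents $P,\Gamma\Rightarrow\Delta,P$ ($P$ atomic) and the rules: $L\wedge$: from $A,B,\Gamma\Rightarrow\Delta$ infer $A\wedge B,\Gamma\Rightarrow\Delta$. $R\wedge$: from $\Gamma\Rightarrow\Delta,A$ and $\Gamma\Rightarrow\Delta,B$ infer $\Gamma\Rightarrow\Delta,A\wedge B$. $L\vee$: from $A,\Gamma\Rightarrow\Delta$ and $B,\Gamma\Rightarrow\Delta$ infer $A\vee B,\Gamma\Rightarrow\Delta$. $R\vee$: from $\Gamma\Rightarrow\Delta,A,B$ infer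 $\Gamma\Rightarrow\Delta,A\vee B$. $L\to$: from $\Gamma\Rightarrow\Delta,A$ and $B,\Gamma\Rightarrow\Delta$ infer $A\to B,\Gamma\Rightarrow\Delta$. $R\to$: from $A,\Gamma\Rightarrow\Delta,B$ infer $\Gamma\Rightarrow\Delta,A\to B$. $L\bot$: infer $\bot,\Gamma\Rightarrow\Delta$ (no premiss). $L\forall$: from $A[x/t],\forall xA,\Gamma\Rightarrow\Delta$ infer $\forall xA,\Gamma\Rightarrow\Delta$. $R\forall$: from $\Gamma\Rightarrow\Delta,A[x/a]$ infer $\Gamma\Rightarrow\Delta,\forall xA$. $L\exists$: from $A[x/a],\Gamma\Rightarrow\Delta$ infer $\exists xA,\Gamma\Rightarrow\Delta$. $R\exists$: from $\Gamma\Rightarrow\Delta,\exists xA,A[x/t]$ infer $\Gamma\Rightarrow\Delta,\exists xA$. In $L\exists$ and the $R\forall$ rules, $a$ is a free variable not occurring in the conclusion. $\mathbf{G3i}$ is $\mathbf{G3c}$ with $L\to,R\to,R\forall$ replaced by: $L^i\to$: from $A\to B,\Gamma\Rightarrow\Delta,A$ and $B,\Gamma\Rightarrow\Delta$ infer $A\to B,\Gamma\Rightarrow\Delta$; $R^i\to$: from $A,\Gamma\Rightarrow B$ infer $\Gamma\Rightarrow\Delta,A\to B$; $R^i\forall$: from $\Gamma\Rightarrow A[x/a]$ infer $\Gamma\Rightarrow\Delta,\forall xA$. $\mathbf{G3m}$ is $\mathbf{G3i}$ with $L\bot$ replaced by the initial sequents $\bot,\Gamma\Rightarrow\Delta,\bot$.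 $\mathbf{G3[mic]}$ denotes any of the three; $\mathbf{G3[mic]}^{\mathcal R}$ is it together with the rules in $\mathcal R$. Two calculi are equivalent if they derive the same sequents. Structural rules: weakening (from $\Gamma\Rightarrow\Delta$ infer $A,\Gamma\Rightarrow\Delta$; from $\Gamma\Rightarrow\Delta$ infer $\Gamma\Rightarrow\Delta,A$), contraction (from $A,A,\Gamma\Rightarrow\Delta$ infer $A,\Gamma\Rightarrow\Delta$; from $\Gamma\Rightarrow\Delta,A,A$ infer $\Gamma\Rightarrow\Delta,A$), and Cut (from $\Gamma\Rightarrow\Delta,A$ and $A,\Lambda\Rightarrow\Theta$ infer $\Gamma,\Lambda\Rightarrow\Delta,\Theta$), for arbitrary formulas $A$. A rule is admissible in a calculus if its conclusion is derivable whenever its premisses are. Equality rules ($P$ atomic, possibly an equality). $\mathrm{Ref}$: from $t=t,\Gamma\Rightarrow\Delta$ infer $\Gamma\Rightarrow\Delta$. $\mathrm{Rep}$: from $s=r,P[x/s],P[x/r],\Gamma\Rightarrow\Delta$ infer $s=r,P[x/s],\Gamma\Rightarrow\Delta$. $\mathrm{Rep}_1^{l}$: from $r=s,P[x/r],\Gamma\Rightarrow\Delta$ infer $r=s,P[x/s],\Gamma\Rightarrow\Delta$. $\mathrm{Rep}_2^{l}$: from $s=r,P[x/r],\Gamma\Rightarrow\Delta$ infer $s=r,P[x/s],\Gamma\Rightarrow\Delta$. *)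

theory Defs
  imports Main "HOL-Library.Multiset"
begin

text \<open>
  Free and bound variables are two disjoint sorts of names. A formula proper has no free
  occurrence of a bound variable (see \<open>wf_fm\<close> below), and only terms without bound variables
  are ever substituted into formulas, so that no capture can occur.
\<close>

datatype var = Free nat | Bound nat

datatype 'f tm = Var var | Fn 'f "'f tm list"

datatype ('f, 'p) fm =
    Rel 'p "'f tm list"
  | Eq "'f tm" "'f tm"
  | Bot
  | Conj "('f, 'p) fm" "('f, 'p) fm"
  | Disj "('f, 'p) fm" "('f, 'p) fm"
  | Imp "('f, 'p) fm" "('f, 'p) fm"
  | All nat "('f, 'p) fm"
  | Ex nat "('f, 'p) fm"

text \<open>
  Function and relation symbols come with their arities; constants are the function symbols of
  arity 0. Either set may be empty.
\<close>

record ('f, 'p) lang =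
  funs :: "('f \<times> nat) set"
  rels :: "('p \<times> nat) set"

text \<open>The argument \<open>B\<close> collects the bound variables in whose scope the expression stands.\<close>

primrec wf_var :: "nat set \<Rightarrow> var \<Rightarrow> bool" where
  "wf_var B (Free a) = True"
| "wf_var B (Bound x) = (x \<in> B)"

primrec wf_tm :: "('f, 'p) lang \<Rightarrow> nat set \<Rightarrow> 'f tm \<Rightarrow> bool" where
  "wf_tm L B (Var v) = wf_var B v"
| "wf_tm L B (Fn f ts) = ((f, length ts) \<in> funs L \<and> list_all (wf_tm L B) ts)"

primrec wf_fm :: "('f, 'p) lang \<Rightarrow> nat set \<Rightarrow> ('f, 'p) fm \<Rightarrow> bool" where
  "wf_fm L B (Rel p ts) = ((p, length ts) \<in> rels L \<and> list_all (wf_tm L B) ts)"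
| "wf_fm L B (Eq t u) = (wf_tm L B t \<and> wf_tm L B u)"
| "wf_fm L B Bot = True"
| "wf_fm L B (Conj F G) = (wf_fm L B F \<and> wf_fm L B G)"
| "wf_fm L B (Disj F G) = (wf_fm L B F \<and> wf_fm L B G)"
| "wf_fm L B (Imp F G) = (wf_fm L B F \<and> wf_fm L B G)"
| "wf_fm L B (All x F) = wf_fm L (insert x B) F"
| "wf_fm L B (Ex x F) = wf_fm L (insert x B) F"

definition is_term :: "('f, 'p) lang \<Rightarrow> 'f tm \<Rightarrow> bool" where
  "is_term L t \<longleftrightarrow> wf_tm L {} t"

definition is_formula :: "('f, 'p) lang \<Rightarrow> ('f, 'p) fm \<Rightarrow> bool" where
  "is_formula L F \<longleftrightarrow> wf_fm L {} F"

fun atomic :: "('f, 'p) fm \<Rightarrow> bool" where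
  "atomic (Rel p ts) = True"
| "atomic (Eq t u) = True"
| "atomic _ = False"

primrec vars_tm :: "'f tm \<Rightarrow> var set" where
  "vars_tm (Var v) = {v}"
| "vars_tm (Fn f ts) = \<Union> (set (map vars_tm ts))"

primrec free_vars :: "('f, 'p) fm \<Rightarrow> var set" where
  "free_vars (Rel p ts) = \<Union> (set (map vars_tm ts))"
| "free_vars (Eq t u) = vars_tm t \<union> vars_tm u"
| "free_vars Bot = {}"
| "free_vars (Conj F G) = free_vars F \<union> free_vars G"
| "free_vars (Disj F G) = free_vars F \<union> free_vars G"
| "free_vars (Imp F G) = free_vars F \<union> free_vars G"
| "free_vars (All x F) = free_vars F - {Bound x}"
| "free_vars (Ex x F) = free_vars F - {Bound x}"

primrec subst_tm :: "'f tm \<Rightarrow> var \<Rightarrow> 'f tm \<Rightarrow> 'f tm"  ("_\<langle>_'/_\<rangle>\<^sub>t" [1000, 0, 0] 1000) where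
  "(Var w)\<langle>v/r\<rangle>\<^sub>t = (if w = v then r else Var w)"
| "(Fn f ts)\<langle>v/r\<rangle>\<^sub>t = Fn f (map (\<lambda>t. t\<langle>v/r\<rangle>\<^sub>t) ts)"

primrec subst :: "('f, 'p) fm \<Rightarrow> var \<Rightarrow> 'f tm \<Rightarrow> ('f, 'p) fm"  ("_\<langle>_'/_\<rangle>" [1000, 0, 0] 1000) where
  "(Rel p ts)\<langle>v/r\<rangle> = Rel p (map (\<lambda>t. t\<langle>v/r\<rangle>\<^sub>t) ts)"
| "(Eq t u)\<langle>v/r\<rangle> = Eq (t\<langle>v/r\<rangle>\<^sub>t) (u\<langle>v/r\<rangle>\<^sub>t)"
| "Bot\<langle>v/r\<rangle> = Bot"
| "(Conj F G)\<langle>v/r\<rangle> = Conj (F\<langle>v/r\<rangle>) (G\<langle>v/r\<rangle>)"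
| "(Disj F G)\<langle>v/r\<rangle> = Disj (F\<langle>v/r\<rangle>) (G\<langle>v/r\<rangle>)"
| "(Imp F G)\<langle>v/r\<rangle> = Imp (F\<langle>v/r\<rangle>) (G\<langle>v/r\<rangle>)"
| "(All x F)\<langle>v/r\<rangle> = (if v = Bound x then All x F else All x (F\<langle>v/r\<rangle>))"
| "(Ex x F)\<langle>v/r\<rangle> = (if v = Bound x then Ex x F else Ex x (F\<langle>v/r\<rangle>))"

datatype ('f, 'p) sequent =
  Sequent "('f, 'p) fm multiset" "('f, 'p) fm multiset"  (infix "\<turnstile>" 50)

primrec is_sequent :: "('f, 'p) lang \<Rightarrow> ('f, 'p) sequent \<Rightarrow> bool" where
  "is_sequent L (\<Gamma> \<turnstile> \<Delta>) \<longleftrightarrow> (\<forall>F \<in># \<Gamma> + \<Delta>. is_formula L F)"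

primrec seq_vars :: "('f, 'p) sequent \<Rightarrow> var set" where
  "seq_vars (\<Gamma> \<turnstile> \<Delta>) = \<Union> (free_vars ` set_mset (\<Gamma> + \<Delta>))"

text \<open>
  A rule is the set of its instances (premisses, conclusion), and a calculus is a set of rules.
  The rules below are stated for raw syntax; that only sequents of the language occur in
  derivations is enforced by \<open>derivable\<close>. The quantifier rules need an explicit condition
  on \<open>t\<close>, since substituting a bound variable could be captured and still give a formula.
\<close>

type_synonym ('f, 'p) rule = "(('f, 'p) sequent list \<times> ('f, 'p) sequent) set"
type_synonym ('f, 'p) calculus = "('f, 'p) rule set"

inductive derivable :: "('f, 'p) lang \<Rightarrow> ('f, 'p) calculus \<Rightarrow> ('f, 'p) sequent \<Rightarrow> bool"
  for L :: "('f, 'p) lang" and C :: "('f, 'p) calculus" where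
  "\<lbrakk>R \<in> C; (ps, c) \<in> R; is_sequent L c; \<forall>p \<in> set ps. derivable L C p\<rbrakk> \<Longrightarrow> derivable L C c"

definition admissible :: "('f, 'p) lang \<Rightarrow> ('f, 'p) calculus \<Rightarrow> ('f, 'p) rule \<Rightarrow> bool" where
  "admissible L C R \<longleftrightarrow>
    (\<forall>(ps, c) \<in> R. is_sequent L c \<longrightarrow> (\<forall>p \<in> set ps. derivable L C p) \<longrightarrow> derivable L C c)"

definition equivalent :: "('f, 'p) lang \<Rightarrow> ('f, 'p) calculus \<Rightarrow> ('f, 'p) calculus \<Rightarrow> bool" where
  "equivalent L C D \<longleftrightarrow> (\<forall>S. derivable L C S \<longleftrightarrow> derivable L D S)"

definition Init :: "('f, 'p) rule" where
  "Init = {([], add_mset P \<Gamma> \<turnstile> add_mset P \<Delta>) | P \<Gamma> \<Delta>. atomic P}"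

definition LConj :: "('f, 'p) rule" where
  "LConj = {([add_mset A (add_mset B \<Gamma>) \<turnstile> \<Delta>],
             add_mset (Conj A B) \<Gamma> \<turnstile> \<Delta>) | A B \<Gamma> \<Delta>. True}"

definition RConj :: "('f, 'p) rule" where
  "RConj = {([\<Gamma> \<turnstile> add_mset A \<Delta>, \<Gamma> \<turnstile> add_mset B \<Delta>],
             \<Gamma> \<turnstile> add_mset (Conj A B) \<Delta>) | A B \<Gamma> \<Delta>. True}"

definition LDisj :: "('f, 'p) rule" where
  "LDisj = {([add_mset A \<Gamma> \<turnstile> \<Delta>, add_mset B \<Gamma> \<turnstile> \<Delta>],
             add_mset (Disj A B) \<Gamma> \<turnstile> \<Delta>) | A B \<Gamma> \<Delta>. True}"

definition RDisj :: "('f, 'p) rule" where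
  "RDisj = {([\<Gamma> \<turnstile> add_mset A (add_mset B \<Delta>)],
             \<Gamma> \<turnstile> add_mset (Disj A B) \<Delta>) | A B \<Gamma> \<Delta>. True}"

definition LImp :: "('f, 'p) rule" where
  "LImp = {([\<Gamma> \<turnstile> add_mset A \<Delta>, add_mset B \<Gamma> \<turnstile> \<Delta>],
            add_mset (Imp A B) \<Gamma> \<turnstile> \<Delta>) | A B \<Gamma> \<Delta>. True}"

definition RImp :: "('f, 'p) rule" where
  "RImp = {([add_mset A \<Gamma> \<turnstile> add_mset B \<Delta>],
            \<Gamma> \<turnstile> add_mset (Imp A B) \<Delta>) | A B \<Gamma> \<Delta>. True}"

definition LBot :: "('f, 'p) rule" where
  "LBot = {([], add_mset Bot \<Gamma> \<turnstile> \<Delta>) | \<Gamma> \<Delta>. True}"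

definition LAll :: "('f, 'p) lang \<Rightarrow> ('f, 'p) rule" where
  "LAll L = {([add_mset (A\<langle>Bound x/t\<rangle>) (add_mset (All x A) \<Gamma>) \<turnstile> \<Delta>],
              add_mset (All x A) \<Gamma> \<turnstile> \<Delta>) | A x t \<Gamma> \<Delta>. is_term L t}"

definition RAll :: "('f, 'p) rule" where
  "RAll = {([\<Gamma> \<turnstile> add_mset (A\<langle>Bound x/Var (Free a)\<rangle>) \<Delta>],
            \<Gamma> \<turnstile> add_mset (All x A) \<Delta>) | A x a \<Gamma> \<Delta>.
            Free a \<notin> seq_vars (\<Gamma> \<turnstile> add_mset (All x A) \<Delta>)}"

definition LEx :: "('f, 'p) rule" where
  "LEx = {([add_mset (A\<langle>Bound x/Var (Free a)\<rangle>) \<Gamma> \<turnstile> \<Delta>],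
           add_mset (Ex x A) \<Gamma> \<turnstile> \<Delta>) | A x a \<Gamma> \<Delta>.
           Free a \<notin> seq_vars (add_mset (Ex x A) \<Gamma> \<turnstile> \<Delta>)}"

definition REx :: "('f, 'p) lang \<Rightarrow> ('f, 'p) rule" where
  "REx L = {([\<Gamma> \<turnstile> add_mset (Ex x A) (add_mset (A\<langle>Bound x/t\<rangle>) \<Delta>)],
             \<Gamma> \<turnstile> add_mset (Ex x A) \<Delta>) | A x t \<Gamma> \<Delta>. is_term L t}"

definition LImp_i :: "('f, 'p) rule" where
  "LImp_i = {([add_mset (Imp A B) \<Gamma> \<turnstile> add_mset A \<Delta>, add_mset B \<Gamma> \<turnstile> \<Delta>],
              add_mset (Imp A B) \<Gamma> \<turnstile> \<Delta>) | A B \<Gamma> \<Delta>. True}"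

definition RImp_i :: "('f, 'p) rule" where
  "RImp_i = {([add_mset A \<Gamma> \<turnstile> {#B#}],
              \<Gamma> \<turnstile> add_mset (Imp A B) \<Delta>) | A B \<Gamma> \<Delta>. True}"

definition RAll_i :: "('f, 'p) rule" where
  "RAll_i = {([\<Gamma> \<turnstile> {#A\<langle>Bound x/Var (Free a)\<rangle>#}],
              \<Gamma> \<turnstile> add_mset (All x A) \<Delta>) | A x a \<Gamma> \<Delta>.
              Free a \<notin> seq_vars (\<Gamma> \<turnstile> add_mset (All x A) \<Delta>)}"

definition InitBot :: "('f, 'p) rule" where
  "InitBot = {([], add_mset Bot \<Gamma> \<turnstile> add_mset Bot \<Delta>) | \<Gamma> \<Delta>. True}"

definition G3c :: "('f, 'p) lang \<Rightarrow> ('f, 'p) calculus" where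
  "G3c L = {Init, LConj, RConj, LDisj, RDisj, LImp, RImp, LBot, LAll L, RAll, LEx, REx L}"

definition G3i :: "('f, 'p) lang \<Rightarrow> ('f, 'p) calculus" where
  "G3i L = {Init, LConj, RConj, LDisj, RDisj, LImp_i, RImp_i, LBot, LAll L, RAll_i, LEx, REx L}"

definition G3m :: "('f, 'p) lang \<Rightarrow> ('f, 'p) calculus" where
  "G3m L = {Init, LConj, RConj, LDisj, RDisj, LImp_i, RImp_i, InitBot, LAll L, RAll_i, LEx, REx L}"

definition LWeak :: "('f, 'p) rule" where
  "LWeak = {([\<Gamma> \<turnstile> \<Delta>], add_mset A \<Gamma> \<turnstile> \<Delta>) | A \<Gamma> \<Delta>. True}"

definition RWeak :: "('f, 'p) rule" where
  "RWeak = {([\<Gamma> \<turnstile> \<Delta>], \<Gamma> \<turnstile> add_mset A \<Delta>) | A \<Gamma> \<Delta>. True}"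

definition LContr :: "('f, 'p) rule" where
  "LContr = {([add_mset A (add_mset A \<Gamma>) \<turnstile> \<Delta>], add_mset A \<Gamma> \<turnstile> \<Delta>) | A \<Gamma> \<Delta>. True}"

definition RContr :: "('f, 'p) rule" where
  "RContr = {([\<Gamma> \<turnstile> add_mset A (add_mset A \<Delta>)], \<Gamma> \<turnstile> add_mset A \<Delta>) | A \<Gamma> \<Delta>. True}"

definition Cut :: "('f, 'p) rule" where
  "Cut = {([\<Gamma> \<turnstile> add_mset A \<Delta>, add_mset A \<Lambda> \<turnstile> \<Theta>],
           \<Gamma> + \<Lambda> \<turnstile> \<Delta> + \<Theta>) | A \<Gamma> \<Delta> \<Lambda> \<Theta>. True}"

definition structural_rules :: "('f, 'p) rule set" where
  "structural_rules = {LWeak, RWeak, LContr, RContr, Cut}"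

definition Ref :: "('f, 'p) rule" where
  "Ref = {([add_mset (Eq t t) \<Gamma> \<turnstile> \<Delta>], \<Gamma> \<turnstile> \<Delta>) | t \<Gamma> \<Delta>. True}"

definition Rep :: "('f, 'p) rule" where
  "Rep = {([add_mset (Eq s r) (add_mset (P\<langle>Free x/s\<rangle>) (add_mset (P\<langle>Free x/r\<rangle>) \<Gamma>)) \<turnstile> \<Delta>],
           add_mset (Eq s r) (add_mset (P\<langle>Free x/s\<rangle>) \<Gamma>) \<turnstile> \<Delta>) | P x s r \<Gamma> \<Delta>. atomic P}"

definition Rep1l :: "('f, 'p) rule" where
  "Rep1l = {([add_mset (Eq r s) (add_mset (P\<langle>Free x/r\<rangle>) \<Gamma>) \<turnstile> \<Delta>],
             add_mset (Eq r s) (add_mset (P\<langle>Free x/s\<rangle>) \<Gamma>) \<turnstile> \<Delta>) | P x s r \<Gamma> \<Delta>. atomic P}"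

definition Rep2l :: "('f, 'p) rule" where
  "Rep2l = {([add_mset (Eq s r) (add_mset (P\<langle>Free x/r\<rangle>) \<Gamma>) \<turnstile> \<Delta>],
             add_mset (Eq s r) (add_mset (P\<langle>Free x/s\<rangle>) \<Gamma>) \<turnstile> \<Delta>) | P x s r \<Gamma> \<Delta>. atomic P}"

end

theory Submission
  imports Defs
begin

text \<open>
  The equality rules act only on atoms, and what a set of atoms yields under them is the
  congruence closure of its equations, applied to its other atoms. This suggests a calculus
  \<open>der\<close> in which equality appears only in the axioms: \<open>\<Gamma> \<Rightarrow> \<Delta>\<close> is an axiom if some
  atom of \<open>\<Delta>\<close> is entailed, up to the congruence generated by the equations of \<open>\<Gamma>\<close>, by
  the atoms of \<open>\<Gamma>\<close>. Entailment between atoms is closed under composition (\<open>entails_cut\<close>), so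
  that cuts on atoms disappear at the leaves, and the remaining cut elimination is the one of
  pure logic (\<open>cut\<close>). Sequents of \<open>der\<close> consist of sets and its rules keep their principal
  formula, so that contraction is built in and weakening is an immediate induction. Its
  eigenvariable rules have one premiss for each term, so that quantified cut formulas can be
  reduced without substituting in derivations.

  The theorem follows once \<open>der\<close> is seen to derive the same sequents as each of the logical
  calculi extended by \<open>Ref\<close> and one of the three replacement rules: the structural rules
  transfer from \<open>der\<close>, and the three extensions are equivalent to each other
  (\<open>derivable_iff_der\<close>).

  From a given calculus to \<open>der\<close> (\<open>soundness\<close>), one proves that all instances of a derivable
  sequent are derivable in \<open>der\<close>. This provides the premisses of the eigenvariable rules for
  all terms. The equality rules are harmless because the atom that they introduce into the
  premiss is entailed by the conclusion.

  From \<open>der\<close> to a given calculus (\<open>completeness\<close>) there are two points. The first is that the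
  given calculi consume principal formulas and count occurrences. This is met by showing more:
  a derivation of a set sequent yields a derivation of each multiset sequent that covers it.
  A sequent covers not only its own formulas, but also those that have been decomposed by an
  invertible rule into formulas that it covers, so that after a decomposition the consumed
  formula is still accounted for. The second point is that the axioms have to be derived from
  \<open>Ref\<close> and the replacement rule, although \<open>Rep2l\<close> and \<open>Rep1l\<close> each destroy the atom that is
  rewritten and use an equation in one direction only (\<open>derivable_entailed\<close>). By rewriting one
  side of an instance of \<open>t = t\<close>, supplied by \<open>Ref\<close>, an equation can be reversed while the
  original is kept, so that rewriting is possible in both directions. An entailed atom is then
  reached by a linear chain of rewritings of a single atom which is either an instance of
  \<open>t = t\<close> or not an equation, so that no equation is ever used up.
\<close>

section \<open>Entailment between atoms\<close>

inductive cong :: "('f, 'p) fm set \<Rightarrow> 'f tm \<Rightarrow> 'f tm \<Rightarrow> bool" for \<Gamma> where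
  base: "Eq s r \<in> \<Gamma> \<Longrightarrow> cong \<Gamma> s r"
| refl: "cong \<Gamma> t t"
| sym: "cong \<Gamma> t u \<Longrightarrow> cong \<Gamma> u t"
| trans: "cong \<Gamma> t u \<Longrightarrow> cong \<Gamma> u v \<Longrightarrow> cong \<Gamma> t v"
| Fn: "list_all2 (cong \<Gamma>) ts us \<Longrightarrow> cong \<Gamma> (Fn f ts) (Fn f us)"

text \<open>
  An atom that is not an equation contributes nothing to the congruence, so a single such atom
  of \<open>\<Gamma>\<close> is what another one is obtained from.
\<close>

fun entails :: "('f, 'p) fm set \<Rightarrow> ('f, 'p) fm \<Rightarrow> bool" where
  "entails \<Gamma> (Rel p ts) \<longleftrightarrow> (\<exists>us. Rel p us \<in> \<Gamma> \<and> list_all2 (cong \<Gamma>) us ts)"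
| "entails \<Gamma> (Eq t u) \<longleftrightarrow> cong \<Gamma> t u"
| "entails \<Gamma> _ \<longleftrightarrow> False"

lemma entails_atomic: "entails \<Gamma> P \<Longrightarrow> atomic P"
  by (cases P) auto

lemma entails_member: "atomic P \<Longrightarrow> P \<in> \<Gamma> \<Longrightarrow> entails \<Gamma> P"
  by (cases P) (auto intro: cong.base cong.refl list_all2_refl)

lemma cong_cut:
  assumes "cong \<Gamma> t u" "\<And>s r. Eq s r \<in> \<Gamma> \<Longrightarrow> cong \<Gamma>' s r"
  shows "cong \<Gamma>' t u"
  using assms(1)
proof induction
  case (Fn ts us f)
  then show ?case by (auto intro!: cong.Fn elim: list_all2_mono)
qed (auto intro: assms(2) cong.intros)

text \<open>
  Transitivity of entailment. It makes atomic cuts admissible, and it allows the atoms of an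
  antecedent to be exchanged for atoms that entail them.
\<close>

lemma entails_cut:
  assumes "entails \<Gamma> Q" "\<And>P. P \<in> \<Gamma> \<Longrightarrow> atomic P \<Longrightarrow> entails \<Gamma>' P"
  shows "entails \<Gamma>' Q"
proof -
  have cong: "cong \<Gamma>' t u" if "cong \<Gamma> t u" for t u
    using that by (rule cong_cut) (use assms(2)[of "Eq _ _"] in auto)
  show ?thesis
  proof (cases Q)
    case (Rel p ts)
    then obtain us where us: "Rel p us \<in> \<Gamma>" "list_all2 (cong \<Gamma>) us ts"
      using assms(1) by auto
    then obtain vs where "Rel p vs \<in> \<Gamma>'" "list_all2 (cong \<Gamma>') vs us"
      using assms(2)[of "Rel p us"] by auto
    moreover have "list_all2 (cong \<Gamma>') us ts"
      using us(2) by (rule list_all2_mono) (rule cong)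
    ultimately show ?thesis
      using Rel list_all2_trans[of "cong \<Gamma>'" "cong \<Gamma>'" "cong \<Gamma>'"] cong.trans
      by (metis entails.simps(1))
  qed (use assms(1) cong in auto)
qed

lemma entails_mono: "entails \<Gamma> P \<Longrightarrow> \<Gamma> \<subseteq> \<Gamma>' \<Longrightarrow> entails \<Gamma>' P"
  by (erule entails_cut) (auto intro: entails_member)

section \<open>Simultaneous instantiation of free variables\<close>

primrec inst_tm :: "(nat \<Rightarrow> 'f tm) \<Rightarrow> 'f tm \<Rightarrow> 'f tm" where
  "inst_tm \<sigma> (Var v) = (case v of Free a \<Rightarrow> \<sigma> a | Bound x \<Rightarrow> Var (Bound x))"
| "inst_tm \<sigma> (Fn f ts) = Fn f (map (inst_tm \<sigma>) ts)"

primrec inst :: "(nat \<Rightarrow> 'f tm) \<Rightarrow> ('f, 'p) fm \<Rightarrow> ('f, 'p) fm" where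
  "inst \<sigma> (Rel p ts) = Rel p (map (inst_tm \<sigma>) ts)"
| "inst \<sigma> (Eq t u) = Eq (inst_tm \<sigma> t) (inst_tm \<sigma> u)"
| "inst \<sigma> Bot = Bot"
| "inst \<sigma> (Conj F G) = Conj (inst \<sigma> F) (inst \<sigma> G)"
| "inst \<sigma> (Disj F G) = Disj (inst \<sigma> F) (inst \<sigma> G)"
| "inst \<sigma> (Imp F G) = Imp (inst \<sigma> F) (inst \<sigma> G)"
| "inst \<sigma> (All x F) = All x (inst \<sigma> F)"
| "inst \<sigma> (Ex x F) = Ex x (inst \<sigma> F)"

lemma inst_tm_id [simp]: "inst_tm (\<lambda>a. Var (Free a)) t = t"
  by (induction t) (auto split: var.split simp: map_idI)

lemma inst_id [simp]: "inst (\<lambda>a. Var (Free a)) F = F"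
  by (induction F) (auto simp: map_idI)

lemma inst_tm_cong:
  "(\<And>a. Free a \<in> vars_tm t \<Longrightarrow> \<sigma> a = \<tau> a) \<Longrightarrow> inst_tm \<sigma> t = inst_tm \<tau> t"
  by (induction t) (auto split: var.split)

lemma inst_cong:
  "(\<And>a. Free a \<in> free_vars F \<Longrightarrow> \<sigma> a = \<tau> a) \<Longrightarrow> inst \<sigma> F = inst \<tau> F"
  by (induction F) (auto intro!: inst_tm_cong)

lemma subst_tm_idle: "v \<notin> vars_tm t \<Longrightarrow> t\<langle>v/r\<rangle>\<^sub>t = t"
  by (induction t) (auto simp: map_idI)

lemma wf_tm_vars: "wf_tm L B t \<Longrightarrow> Bound x \<in> vars_tm t \<Longrightarrow> x \<in> B"
  by (induction t) (auto simp: list_all_iff)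

lemma wf_inst_tm:
  "wf_tm L B t \<Longrightarrow> (\<And>a. wf_tm L B (\<sigma> a)) \<Longrightarrow> wf_tm L B (inst_tm \<sigma> t)"
  by (induction t) (auto simp: list_all_iff split: var.split)

lemma inst_tm_subst_Bound:
  assumes "\<And>a. is_term L (\<sigma> a)"
  shows "inst_tm \<sigma> (s\<langle>Bound x/t\<rangle>\<^sub>t) = (inst_tm \<sigma> s)\<langle>Bound x/inst_tm \<sigma> t\<rangle>\<^sub>t"
proof (induction s)
  case (Var v)
  have "Bound x \<notin> vars_tm (\<sigma> a)" for a
    using assms wf_tm_vars unfolding is_term_def by fastforce
  then show ?case by (cases v) (auto simp: subst_tm_idle)
qed auto

lemma inst_subst_Bound:
  assumes "\<And>a. is_term L (\<sigma> a)"
  shows "inst \<sigma> (F\<langle>Bound x/t\<rangle>) = (inst \<sigma> F)\<langle>Bound x/inst_tm \<sigma> t\<rangle>"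
  by (induction F) (auto simp: inst_tm_subst_Bound[OF assms])

text \<open>
  Assigning \<open>t\<close> to an eigenvariable turns the premiss of an eigenvariable rule into the premiss
  for the term \<open>t\<close>.
\<close>

lemma inst_subst_fresh:
  assumes "\<And>a. is_term L (\<sigma> a)" "is_term L t" "Free a \<notin> free_vars F"
  shows "inst (\<sigma>(a := t)) (F\<langle>Bound x/Var (Free a)\<rangle>) = (inst \<sigma> F)\<langle>Bound x/t\<rangle>"
proof -
  have "inst (\<sigma>(a := t)) F = inst \<sigma> F"
    using assms(3) by (auto intro: inst_cong)
  then show ?thesis
    using inst_subst_Bound[of L "\<sigma>(a := t)" F x "Var (Free a)"] assms(1,2) by simp
qed

lemma cong_inst_subst:
  assumes "cong \<Gamma> (inst_tm \<sigma> s) (inst_tm \<sigma> r)"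
  shows "cong \<Gamma> (inst_tm \<sigma> (t\<langle>v/s\<rangle>\<^sub>t)) (inst_tm \<sigma> (t\<langle>v/r\<rangle>\<^sub>t))"
proof (induction t)
  case (Fn f ts)
  then show ?case by (auto intro!: cong.Fn simp: list_all2_conv_all_nth)
qed (auto intro: assms cong.refl)

text \<open>
  The atom that a replacement rule adds to its premiss is entailed by the conclusion, in each
  instance of the rule.
\<close>

lemma entails_inst_subst:
  assumes sr: "cong \<Gamma> (inst_tm \<sigma> s) (inst_tm \<sigma> r)" and P: "inst \<sigma> (P\<langle>v/s\<rangle>) \<in> \<Gamma>" "atomic P"
  shows "entails \<Gamma> (inst \<sigma> (P\<langle>v/r\<rangle>))"
proof (cases P)
  case (Rel p ts)
  have "list_all2 (cong \<Gamma>) (map (inst_tm \<sigma>) (map (\<lambda>t. t\<langle>v/s\<rangle>\<^sub>t) ts))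
      (map (inst_tm \<sigma>) (map (\<lambda>t. t\<langle>v/r\<rangle>\<^sub>t) ts))"
    by (auto simp: list_all2_conv_all_nth intro: cong_inst_subst[OF sr])
  then show ?thesis using P(1) Rel by auto
next
  case (Eq t u)
  then have "cong \<Gamma> (inst_tm \<sigma> (t\<langle>v/s\<rangle>\<^sub>t)) (inst_tm \<sigma> (u\<langle>v/s\<rangle>\<^sub>t))"
    using P(1) by (auto intro: cong.base)
  then show ?thesis
    using Eq cong_inst_subst[OF sr] by simp (metis cong.trans cong.sym)
qed (use P in auto)

section \<open>A cumulative calculus with equality in the axioms\<close>

datatype logic = Minimal | Intuitionistic | Classical

text \<open>
  The part of the succedent that the right rules of implication and universal quantification
  hand on to their premiss.
\<close>

definition side :: "logic \<Rightarrow> ('f, 'p) fm set \<Rightarrow> ('f, 'p) fm set" where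
  "side K \<Delta> = (if K = Classical then \<Delta> else {})"

text \<open>
  The premisses of \<open>rall\<close> and \<open>lex\<close> range over all terms; this replaces the eigenvariable
  condition, and a cut on a quantified formula finds among them the premiss for the term that
  was chosen on the other side. In minimal logic \<open>Bot\<close> behaves like an atom without equality
  reasoning, which is expressed by the condition in \<open>bot\<close>.
\<close>

inductive der :: "logic \<Rightarrow> ('f, 'p) lang \<Rightarrow> ('f, 'p) fm set \<Rightarrow> ('f, 'p) fm set \<Rightarrow> bool"
  for K L where
  ax: "entails \<Gamma> P \<Longrightarrow> P \<in> \<Delta> \<Longrightarrow> der K L \<Gamma> \<Delta>"
| bot: "Bot \<in> \<Gamma> \<Longrightarrow> (K = Minimal \<Longrightarrow> Bot \<in> \<Delta>) \<Longrightarrow> der K L \<Gamma> \<Delta>"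
| lconj: "Conj A B \<in> \<Gamma> \<Longrightarrow> der K L (insert A (insert B \<Gamma>)) \<Delta> \<Longrightarrow> der K L \<Gamma> \<Delta>"
| rconj: "Conj A B \<in> \<Delta> \<Longrightarrow> der K L \<Gamma> (insert A \<Delta>) \<Longrightarrow> der K L \<Gamma> (insert B \<Delta>) \<Longrightarrow> der K L \<Gamma> \<Delta>"
| ldisj: "Disj A B \<in> \<Gamma> \<Longrightarrow> der K L (insert A \<Gamma>) \<Delta> \<Longrightarrow> der K L (insert B \<Gamma>) \<Delta> \<Longrightarrow> der K L \<Gamma> \<Delta>"
| rdisj: "Disj A B \<in> \<Delta> \<Longrightarrow> der K L \<Gamma> (insert A (insert B \<Delta>)) \<Longrightarrow> der K L \<Gamma> \<Delta>"
| limp: "Imp A B \<in> \<Gamma> \<Longrightarrow> der K L \<Gamma> (insert A \<Delta>) \<Longrightarrow> der K L (insert B \<Gamma>) \<Delta> \<Longrightarrow> der K L \<Gamma> \<Delta>"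
| rimp: "Imp A B \<in> \<Delta> \<Longrightarrow> der K L (insert A \<Gamma>) (insert B (side K \<Delta>)) \<Longrightarrow> der K L \<Gamma> \<Delta>"
| lall: "All x A \<in> \<Gamma> \<Longrightarrow> is_term L t \<Longrightarrow> der K L (insert (A\<langle>Bound x/t\<rangle>) \<Gamma>) \<Delta> \<Longrightarrow> der K L \<Gamma> \<Delta>"
| rall: "All x A \<in> \<Delta> \<Longrightarrow> (\<And>t. is_term L t \<Longrightarrow> der K L \<Gamma> (insert (A\<langle>Bound x/t\<rangle>) (side K \<Delta>))) \<Longrightarrow>
    der K L \<Gamma> \<Delta>"
| lex: "Ex x A \<in> \<Gamma> \<Longrightarrow> (\<And>t. is_term L t \<Longrightarrow> der K L (insert (A\<langle>Bound x/t\<rangle>) \<Gamma>) \<Delta>) \<Longrightarrow>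
    der K L \<Gamma> \<Delta>"
| rex: "Ex x A \<in> \<Delta> \<Longrightarrow> is_term L t \<Longrightarrow> der K L \<Gamma> (insert (A\<langle>Bound x/t\<rangle>) \<Delta>) \<Longrightarrow> der K L \<Gamma> \<Delta>"

lemma side_mono: "\<Delta> \<subseteq> \<Delta>' \<Longrightarrow> side K \<Delta> \<subseteq> side K \<Delta>'"
  by (auto simp: side_def)

lemma side_subset: "side K \<Delta> \<subseteq> \<Delta>"
  by (auto simp: side_def)

lemma weakening: "der K L \<Gamma> \<Delta> \<Longrightarrow> \<Gamma> \<subseteq> \<Gamma>' \<Longrightarrow> \<Delta> \<subseteq> \<Delta>' \<Longrightarrow> der K L \<Gamma>' \<Delta>'"
proof (induction arbitrary: \<Gamma>' \<Delta>' rule: der.induct)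
  case (ax \<Gamma> P \<Delta>)
  then show ?case by (meson der.ax entails_mono subsetD)
next
  case (bot \<Gamma> \<Delta>)
  then show ?case by (meson der.bot subsetD)
next
  case (lconj A B \<Gamma> \<Delta>)
  then show ?case by (meson der.lconj insert_mono subsetD)
next
  case (rconj A B \<Delta> \<Gamma>)
  then show ?case by (meson der.rconj insert_mono subsetD)
next
  case (ldisj A B \<Gamma> \<Delta>)
  then show ?case by (meson der.ldisj insert_mono subsetD)
next
  case (rdisj A B \<Delta> \<Gamma>)
  then show ?case by (meson der.rdisj insert_mono subsetD)
next
  case (limp A B \<Gamma> \<Delta>)
  then show ?case by (meson der.limp insert_mono subsetD)
next
  case (rimp A B \<Delta> \<Gamma>)
  then show ?case by (meson der.rimp insert_mono subsetD side_mono)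
next
  case (lall x A \<Gamma> t \<Delta>)
  then show ?case by (meson der.lall insert_mono subsetD)
next
  case (rall x A \<Delta> \<Gamma>)
  then show ?case by (meson der.rall insert_mono subsetD side_mono)
next
  case (lex x A \<Gamma> \<Delta>)
  then show ?case by (meson der.lex insert_mono subsetD)
next
  case (rex x A \<Delta> t \<Gamma>)
  then show ?case by (meson der.rex insert_mono subsetD)
qed

text \<open>
  A formula is absorbed by a sequent if it becomes redundant there by reading invertible rules
  from conclusion to premiss: for instance, \<open>A \<and> B\<close> is redundant on the left next to \<open>A\<close> and \<open>B\<close>,
  and on the right next to \<open>A\<close> alone. The clauses restricted to classical logic belong to premisses
  which, in the other logics, keep the implication or lose the rest of the succedent. There is
  no clause for \<open>\<forall>\<close> on the left and \<open>\<exists>\<close> on the right, whose rules keep the principal formula.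
  An atom is also redundant on the left if it is entailed.
\<close>

inductive absorbs_left :: "logic \<Rightarrow> ('f, 'p) lang \<Rightarrow> ('f, 'p) fm set \<Rightarrow> ('f, 'p) fm set \<Rightarrow>
      ('f, 'p) fm \<Rightarrow> bool"
  and absorbs_right :: "logic \<Rightarrow> ('f, 'p) lang \<Rightarrow> ('f, 'p) fm set \<Rightarrow> ('f, 'p) fm set \<Rightarrow>
      ('f, 'p) fm \<Rightarrow> bool"
  for K L \<Gamma> \<Delta> where
  left: "F \<in> \<Gamma> \<Longrightarrow> absorbs_left K L \<Gamma> \<Delta> F"
| entailed: "entails \<Gamma> P \<Longrightarrow> absorbs_left K L \<Gamma> \<Delta> P"
| lconj: "absorbs_left K L \<Gamma> \<Delta> A \<Longrightarrow> absorbs_left K L \<Gamma> \<Delta> B \<Longrightarrow> absorbs_left K L \<Gamma> \<Delta> (Conj A B)"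
| ldisj1: "absorbs_left K L \<Gamma> \<Delta> A \<Longrightarrow> absorbs_left K L \<Gamma> \<Delta> (Disj A B)"
| ldisj2: "absorbs_left K L \<Gamma> \<Delta> B \<Longrightarrow> absorbs_left K L \<Gamma> \<Delta> (Disj A B)"
| limp1: "K = Classical \<Longrightarrow> absorbs_right K L \<Gamma> \<Delta> A \<Longrightarrow> absorbs_left K L \<Gamma> \<Delta> (Imp A B)"
| limp2: "absorbs_left K L \<Gamma> \<Delta> B \<Longrightarrow> absorbs_left K L \<Gamma> \<Delta> (Imp A B)"
| lex: "is_term L t \<Longrightarrow> absorbs_left K L \<Gamma> \<Delta> (A\<langle>Bound x/t\<rangle>) \<Longrightarrow> absorbs_left K L \<Gamma> \<Delta> (Ex x A)"
| right: "F \<in> \<Delta> \<Longrightarrow> absorbs_right K L \<Gamma> \<Delta> F"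
| rconj1: "absorbs_right K L \<Gamma> \<Delta> A \<Longrightarrow> absorbs_right K L \<Gamma> \<Delta> (Conj A B)"
| rconj2: "absorbs_right K L \<Gamma> \<Delta> B \<Longrightarrow> absorbs_right K L \<Gamma> \<Delta> (Conj A B)"
| rdisj: "absorbs_right K L \<Gamma> \<Delta> A \<Longrightarrow> absorbs_right K L \<Gamma> \<Delta> B \<Longrightarrow> absorbs_right K L \<Gamma> \<Delta> (Disj A B)"
| rimp: "K = Classical \<Longrightarrow> absorbs_left K L \<Gamma> \<Delta> A \<Longrightarrow> absorbs_right K L \<Gamma> \<Delta> B \<Longrightarrow>
    absorbs_right K L \<Gamma> \<Delta> (Imp A B)"
| rall: "K = Classical \<Longrightarrow> is_term L t \<Longrightarrow> absorbs_right K L \<Gamma> \<Delta> (A\<langle>Bound x/t\<rangle>) \<Longrightarrow>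
    absorbs_right K L \<Gamma> \<Delta> (All x A)"

lemma absorbs_left_entailed:
  assumes "entails \<Gamma> P" "\<And>F. F \<in> \<Gamma> \<Longrightarrow> absorbs_left K L \<Gamma>' \<Delta>' F"
  shows "entails \<Gamma>' P"
  using assms(1)
proof (rule entails_cut)
  fix Q assume "Q \<in> \<Gamma>" "atomic Q"
  then show "entails \<Gamma>' Q"
    using assms(2)[of Q] by (auto elim: absorbs_left.cases intro: entails_member)
qed

lemma absorbs_trans:
  assumes "\<And>F. F \<in> \<Gamma> \<Longrightarrow> absorbs_left K L \<Gamma>' \<Delta>' F" "\<And>F. F \<in> \<Delta> \<Longrightarrow> absorbs_right K L \<Gamma>' \<Delta>' F"
  shows "absorbs_left K L \<Gamma> \<Delta> F \<Longrightarrow> absorbs_left K L \<Gamma>' \<Delta>' F"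
    and "absorbs_right K L \<Gamma> \<Delta> G \<Longrightarrow> absorbs_right K L \<Gamma>' \<Delta>' G"
proof (induction rule: absorbs_left_absorbs_right.inducts)
  case (entailed P)
  then show ?case using assms(1) absorbs_left_entailed absorbs_left_absorbs_right.entailed by metis
qed (auto intro: assms absorbs_left_absorbs_right.intros)

text \<open>
  Outside classical logic, absorption on the left never looks at the succedent, so it survives
  the loss of the succedent in the premisses of \<open>R\<longrightarrow>\<close> and \<open>R\<forall>\<close>. The second conclusion is only the
  counterpart that mutual induction asks for.
\<close>

lemma absorbs_left_trans_nonclassical:
  assumes "K \<noteq> Classical" "\<And>F. F \<in> \<Gamma> \<Longrightarrow> absorbs_left K L \<Gamma>' \<Delta>' F"
  shows "absorbs_left K L \<Gamma> \<Delta> F \<Longrightarrow> absorbs_left K L \<Gamma>' \<Delta>' F"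
    and "absorbs_right K L \<Gamma> \<Delta> G \<Longrightarrow> True"
proof (induction rule: absorbs_left_absorbs_right.inducts)
  case (entailed P)
  then show ?case using assms(2) absorbs_left_entailed absorbs_left_absorbs_right.entailed by metis
qed (use assms in \<open>auto intro: absorbs_left_absorbs_right.intros\<close>)

inductive_cases absorbs_left_ConjE: "absorbs_left K L \<Gamma> \<Delta> (Conj A B)"
inductive_cases absorbs_left_DisjE: "absorbs_left K L \<Gamma> \<Delta> (Disj A B)"
inductive_cases absorbs_left_ImpE: "absorbs_left K L \<Gamma> \<Delta> (Imp A B)"
inductive_cases absorbs_left_ExE: "absorbs_left K L \<Gamma> \<Delta> (Ex x A)"
inductive_cases absorbs_left_AllE: "absorbs_left K L \<Gamma> \<Delta> (All x A)"
inductive_cases absorbs_left_BotE: "absorbs_left K L \<Gamma> \<Delta> Bot"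

text \<open>
  One induction gives at once the inversion of the left rules for \<open>\<and>\<close>, \<open>\<or>\<close>, \<open>\<exists>\<close> and (for the second
  premiss) \<open>\<longrightarrow>\<close>, and the exchange of atoms for atoms that entail them. The notion of
  absorption of minimal logic is used for every \<open>K\<close> because it ignores the succedent,
  which changes from conclusion to premiss.
\<close>

lemma absorption:
  assumes "der K L \<Gamma> \<Delta>" "\<forall>F \<in> \<Gamma>. absorbs_left Minimal L \<Gamma>' {} F"
  shows "der K L \<Gamma>' \<Delta>"
  using assms
proof (induction arbitrary: \<Gamma>' rule: der.induct)
  have ins: "\<forall>F \<in> insert A \<Gamma>. absorbs_left Minimal L (insert A \<Gamma>') {} F"
    if "\<forall>F \<in> \<Gamma>. absorbs_left Minimal L \<Gamma>' {} F" for A \<Gamma> \<Gamma>'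
    using that absorbs_left_trans_nonclassical(1)[of Minimal \<Gamma>' L "insert A \<Gamma>'" "{}" "{}"]
    by (auto intro: absorbs_left_absorbs_right.left)
  {
    case (ax \<Gamma> P \<Delta>)
    then show ?case using absorbs_left_entailed by (blast intro: der.ax)
  next
    case (bot \<Gamma> \<Delta>)
    then show ?case by (auto elim!: absorbs_left_BotE intro: der.bot)
  next
    case (lconj A B \<Gamma> \<Delta>)
    from lconj.prems lconj.hyps(1) have "absorbs_left Minimal L \<Gamma>' {} (Conj A B)" by blast
    then show ?case
    proof (rule absorbs_left_ConjE)
      assume "Conj A B \<in> \<Gamma>'"
      then show ?thesis using lconj.IH[OF ins[OF ins[OF lconj.prems]]] by (rule der.lconj)
    qed (use lconj.IH lconj.prems in auto)
  next
    case (rconj A B \<Delta> \<Gamma>)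
    then show ?case by (blast intro: der.rconj)
  next
    case (ldisj A B \<Gamma> \<Delta>)
    from ldisj.prems ldisj.hyps(1) have "absorbs_left Minimal L \<Gamma>' {} (Disj A B)" by blast
    then show ?case
    proof (rule absorbs_left_DisjE)
      assume "Disj A B \<in> \<Gamma>'"
      then show ?thesis
        using ldisj.IH(1)[OF ins[OF ldisj.prems]] ldisj.IH(2)[OF ins[OF ldisj.prems]]
        by (rule der.ldisj)
    qed (use ldisj.IH ldisj.prems in auto)
  next
    case (rdisj A B \<Delta> \<Gamma>)
    then show ?case by (blast intro: der.rdisj)
  next
    case (limp A B \<Gamma> \<Delta>)
    from limp.prems limp.hyps(1) have "absorbs_left Minimal L \<Gamma>' {} (Imp A B)" by blast
    then show ?case
    proof (rule absorbs_left_ImpE)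
      assume "Imp A B \<in> \<Gamma>'"
      then show ?thesis
        using limp.IH(1)[OF limp.prems] limp.IH(2)[OF ins[OF limp.prems]] by (rule der.limp)
    qed (use limp.IH limp.prems in auto)
  next
    case (rimp A B \<Delta> \<Gamma>)
    then show ?case using ins[OF rimp.prems] by (blast intro: der.rimp)
  next
    case (lall x A \<Gamma> t \<Delta>)
    from lall.prems lall.hyps(1) have "absorbs_left Minimal L \<Gamma>' {} (All x A)" by blast
    then show ?case
    proof (rule absorbs_left_AllE)
      assume "All x A \<in> \<Gamma>'"
      then show ?thesis
        using lall.hyps(2) lall.IH[OF ins[OF lall.prems]] by (rule der.lall)
    qed
  next
    case (rall x A \<Delta> \<Gamma>)
    then show ?case by (blast intro: der.rall)
  next
    case (lex x A \<Gamma> \<Delta>)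
    from lex.prems lex.hyps(1) have "absorbs_left Minimal L \<Gamma>' {} (Ex x A)" by blast
    then show ?case
    proof (rule absorbs_left_ExE)
      assume "Ex x A \<in> \<Gamma>'"
      then show ?thesis using lex.IH[OF _ ins[OF lex.prems]] by (rule der.lex)
    qed (use lex.IH lex.prems in auto)
  next
    case (rex x A \<Delta> t \<Gamma>)
    then show ?case by (blast intro: der.rex)
  }
qed

lemma absorption_insert:
  assumes "der K L (insert F \<Gamma>) \<Delta>" "absorbs_left Minimal L \<Gamma> {} F"
  shows "der K L \<Gamma> \<Delta>"
  using assms by (intro absorption[OF assms(1)]) (auto intro: absorbs_left_absorbs_right.left)

lemma cut_entailed: "der K L (insert P \<Gamma>) \<Delta> \<Longrightarrow> entails \<Gamma> P \<Longrightarrow> der K L \<Gamma> \<Delta>"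
  by (erule absorption_insert) (rule absorbs_left_absorbs_right.entailed)

lemma invert_left_Conj:
  assumes "der K L (insert (Conj A B) \<Gamma>) \<Delta>"
  shows "der K L (insert A (insert B \<Gamma>)) \<Delta>"
proof (rule absorption_insert)
  show "der K L (insert (Conj A B) (insert A (insert B \<Gamma>))) \<Delta>"
    using assms by (rule weakening) auto
qed (auto intro: absorbs_left_absorbs_right.intros)

lemma invert_left_Disj:
  assumes "der K L (insert (Disj A B) \<Gamma>) \<Delta>" "C \<in> {A, B}"
  shows "der K L (insert C \<Gamma>) \<Delta>"
proof (rule absorption_insert)
  show "der K L (insert (Disj A B) (insert C \<Gamma>)) \<Delta>"
    using assms(1) by (rule weakening) auto
qed (use assms(2) in \<open>auto intro: absorbs_left_absorbs_right.intros\<close>)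

lemma invert_left_Ex:
  assumes "der K L (insert (Ex x A) \<Gamma>) \<Delta>" "is_term L t"
  shows "der K L (insert (A\<langle>Bound x/t\<rangle>) \<Gamma>) \<Delta>"
proof (rule absorption_insert)
  show "der K L (insert (Ex x A) (insert (A\<langle>Bound x/t\<rangle>) \<Gamma>)) \<Delta>"
    using assms(1) by (rule weakening) auto
qed (use assms(2) in \<open>auto intro: absorbs_left_absorbs_right.intros\<close>)

section \<open>Cut elimination\<close>

text \<open>
  Unlike the size of a formula, this measure is invariant under the substitution of terms.
\<close>

primrec rank :: "('f, 'p) fm \<Rightarrow> nat" where
  "rank (Rel p ts) = 0"
| "rank (Eq t u) = 0"
| "rank Bot = 0"
| "rank (Conj F G) = Suc (rank F + rank G)"
| "rank (Disj F G) = Suc (rank F + rank G)"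
| "rank (Imp F G) = Suc (rank F + rank G)"
| "rank (All x F) = Suc (rank F)"
| "rank (Ex x F) = Suc (rank F)"

lemma rank_subst [simp]: "rank (F\<langle>v/t\<rangle>) = rank F"
  by (induction F) auto

text \<open>
  The case of a cut formula \<open>A \<longrightarrow> B\<close> or \<open>\<forall>x A\<close> that is principal on the left of the cut. The rule
  \<open>L\<longrightarrow>\<close> is invertible in classical logic only, and \<open>L\<forall>\<close> keeps its principal formula; so the right
  derivation is traversed until the cut formula is principal there as well. The two connectives
  share the induction; \<open>prem\<close> stands for the derivability of the premisses of the
  last inference on the left, with the cut formula already removed. It has to grow with the
  antecedent, but only with that part of the succedent which \<open>side\<close> keeps, because
  the induction also passes through inferences that drop the rest.
\<close>

lemma cut_right_principal:
  assumes "der K L \<Gamma>\<^sub>0 \<Delta>" "\<Gamma>\<^sub>0 \<subseteq> insert C \<Gamma>" "prem \<Gamma> \<Delta>"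
    and C: "C \<in> range (case_prod Imp) \<union> range (case_prod All)"
    and mono: "\<And>\<Gamma> \<Delta> \<Gamma>' \<Delta>'. prem \<Gamma> \<Delta> \<Longrightarrow> \<Gamma> \<subseteq> \<Gamma>' \<Longrightarrow> side K \<Delta> \<subseteq> side K \<Delta>' \<Longrightarrow> prem \<Gamma>' \<Delta>'"
    and imp: "\<And>A B \<Gamma> \<Delta>. C = Imp A B \<Longrightarrow> prem \<Gamma> \<Delta> \<Longrightarrow> der K L \<Gamma> (insert A \<Delta>) \<Longrightarrow>
      der K L (insert B \<Gamma>) \<Delta> \<Longrightarrow> der K L \<Gamma> \<Delta>"
    and all: "\<And>x A t \<Gamma> \<Delta>. C = All x A \<Longrightarrow> prem \<Gamma> \<Delta> \<Longrightarrow> is_term L t \<Longrightarrow>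
      der K L (insert (A\<langle>Bound x/t\<rangle>) \<Gamma>) \<Delta> \<Longrightarrow> der K L \<Gamma> \<Delta>"
  shows "der K L \<Gamma> \<Delta>"
  using assms(1-3)
proof (induction arbitrary: \<Gamma> rule: der.induct)
  case (ax \<Gamma>\<^sub>0 P \<Delta>)
  have "entails \<Gamma> P"
    using ax(1) by (rule entails_cut) (use ax(3) C in \<open>auto intro: entails_member\<close>)
  then show ?case using ax(2) by (blast intro: der.ax)
next
  case (bot \<Gamma>\<^sub>0 \<Delta>)
  then have "Bot \<in> \<Gamma>" using C by auto
  then show ?case using bot(2) by (rule der.bot)
next
  case (lconj A B \<Gamma>\<^sub>0 \<Delta>)
  have "der K L (insert A (insert B \<Gamma>)) \<Delta>"
    by (rule lconj.IH, use lconj.prems(1) in blast, rule mono[OF lconj.prems(2)])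
      (auto simp: side_def)
  then show ?case using lconj.hyps(1) lconj.prems(1) C by (auto intro: der.lconj)
next
  case (rconj A B \<Delta> \<Gamma>\<^sub>0)
  have "der K L \<Gamma> (insert A \<Delta>)" "der K L \<Gamma> (insert B \<Delta>)"
    by (rule rconj.IH, use rconj.prems(1) in blast,
        rule mono[OF rconj.prems(2)]; auto simp: side_def)+
  then show ?case using rconj.hyps(1) by (blast intro: der.rconj)
next
  case (ldisj A B \<Gamma>\<^sub>0 \<Delta>)
  have "der K L (insert A \<Gamma>) \<Delta>" "der K L (insert B \<Gamma>) \<Delta>"
    by (rule ldisj.IH, use ldisj.prems(1) in blast,
        rule mono[OF ldisj.prems(2)]; auto simp: side_def)+
  then show ?case using ldisj.hyps(1) ldisj.prems(1) C by (auto intro: der.ldisj)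
next
  case (rdisj A B \<Delta> \<Gamma>\<^sub>0)
  have "der K L \<Gamma> (insert A (insert B \<Delta>))"
    by (rule rdisj.IH, use rdisj.prems(1) in blast, rule mono[OF rdisj.prems(2)])
      (auto simp: side_def)
  then show ?case using rdisj.hyps(1) by (blast intro: der.rdisj)
next
  case (limp A B \<Gamma>\<^sub>0 \<Delta>)
  have A: "der K L \<Gamma> (insert A \<Delta>)"
    by (rule limp.IH, use limp.prems(1) in blast, rule mono[OF limp.prems(2)])
      (auto simp: side_def)
  have B: "der K L (insert B \<Gamma>) \<Delta>"
    by (rule limp.IH, use limp.prems(1) in blast, rule mono[OF limp.prems(2)])
      (auto simp: side_def)
  show ?case
  proof (cases "Imp A B \<in> \<Gamma>")
    case True
    then show ?thesis using A B by (rule der.limp)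
  next
    case False
    then show ?thesis using limp.hyps(1) limp.prems A B by - (rule imp, auto)
  qed
next
  case (rimp A B \<Delta> \<Gamma>\<^sub>0)
  have "der K L (insert A \<Gamma>) (insert B (side K \<Delta>))"
    by (rule rimp.IH, use rimp.prems(1) in blast, rule mono[OF rimp.prems(2)])
      (auto simp: side_def)
  then show ?case using rimp.hyps(1) by (blast intro: der.rimp)
next
  case (lall x A \<Gamma>\<^sub>0 t \<Delta>)
  have A: "der K L (insert (A\<langle>Bound x/t\<rangle>) \<Gamma>) \<Delta>"
    by (rule lall.IH, use lall.prems(1) in blast, rule mono[OF lall.prems(2)])
      (auto simp: side_def)
  show ?case
  proof (cases "All x A \<in> \<Gamma>")
    case True
    then show ?thesis using lall.hyps(2) A by (rule der.lall)
  next
    case False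
    then show ?thesis using lall.hyps(1,2) lall.prems A by - (rule all, auto)
  qed
next
  case (rall x A \<Delta> \<Gamma>\<^sub>0)
  have "der K L \<Gamma> (insert (A\<langle>Bound x/t\<rangle>) (side K \<Delta>))" if "is_term L t" for t
    by (rule rall.IH[OF that], use rall.prems(1) in blast, rule mono[OF rall.prems(2)])
      (auto simp: side_def)
  then show ?case using rall.hyps(1) by (blast intro: der.rall)
next
  case (lex x A \<Gamma>\<^sub>0 \<Delta>)
  have "der K L (insert (A\<langle>Bound x/t\<rangle>) \<Gamma>) \<Delta>" if "is_term L t" for t
    by (rule lex.IH[OF that], use lex.prems(1) in blast, rule mono[OF lex.prems(2)])
      (auto simp: side_def)
  then show ?case using lex.hyps(1) lex.prems(1) C by (auto intro: der.lex)
next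
  case (rex x A \<Delta> t \<Gamma>\<^sub>0)
  have "der K L \<Gamma> (insert (A\<langle>Bound x/t\<rangle>) \<Delta>)"
    by (rule rex.IH, use rex.prems(1) in blast, rule mono[OF rex.prems(2)])
      (auto simp: side_def)
  then show ?case using rex.hyps(1,2) by (blast intro: der.rex)
qed

text \<open>
  The left derivation is traversed first. Where the last inference has dropped the cut formula
  from the succedent, it is simply repeated with another succedent. Where the cut
  formula is principal, \<open>\<and>\<close>, \<open>\<or>\<close> and \<open>\<exists>\<close> are inverted in the right derivation, which avoids
  permuting a cut upwards past a right inference that drops the succedent; \<open>\<longrightarrow>\<close> and \<open>\<forall>\<close> are left to
  \<open>cut_right_principal\<close>, and atoms to \<open>cut_entailed\<close>.
\<close>

lemma cut_left_step:
  assumes "der K L \<Gamma>\<^sub>0 \<Delta>\<^sub>0" "\<Delta>\<^sub>0 \<subseteq> insert C \<Delta>" "der K L (insert C \<Gamma>\<^sub>0) \<Delta>"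
    and cut: "\<And>A \<Gamma> \<Delta>. rank A < rank C \<Longrightarrow> der K L \<Gamma> (insert A \<Delta>) \<Longrightarrow> der K L (insert A \<Gamma>) \<Delta> \<Longrightarrow>
      der K L \<Gamma> \<Delta>"
  shows "der K L \<Gamma>\<^sub>0 \<Delta>"
  using assms(1-3)
proof (induction arbitrary: \<Delta> rule: der.induct)
  have grow: "der K L (insert C \<Gamma>') \<Delta>'" if "der K L (insert C \<Gamma>) \<Delta>" "\<Gamma> \<subseteq> \<Gamma>'" "\<Delta> \<subseteq> \<Delta>'" for \<Gamma> \<Gamma>' \<Delta> \<Delta>'
    using that(1) by (rule weakening) (use that in auto)
  {
    case (ax \<Gamma> P \<Delta>\<^sub>0)
    then show ?case by (cases "P = C") (auto intro: der.ax cut_entailed)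
  next
    case (bot \<Gamma> \<Delta>\<^sub>0)
    show ?case
    proof (cases "C = Bot")
      case True
      then show ?thesis using bot by (simp add: insert_absorb)
    next
      case False
      then show ?thesis using bot by (auto intro: der.bot)
    qed
  next
    case (lconj A B \<Gamma> \<Delta>\<^sub>0)
    have "der K L (insert A (insert B \<Gamma>)) \<Delta>"
      by (rule lconj.IH) (use lconj.prems in \<open>auto intro: grow\<close>)
    then show ?case using lconj.hyps by (blast intro: der.lconj)
  next
    case (rconj A B \<Delta>\<^sub>0 \<Gamma>)
    have A: "der K L \<Gamma> (insert A \<Delta>)" and B: "der K L \<Gamma> (insert B \<Delta>)"
      by (rule rconj.IH; use rconj.prems in \<open>auto intro: grow\<close>)+
    show ?case
    proof (cases "C = Conj A B")
      case True
      then have "der K L (insert B (insert A \<Gamma>)) \<Delta>"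
        using rconj.prems(2) invert_left_Conj by (auto simp: insert_commute)
      moreover have "der K L (insert A \<Gamma>) (insert B \<Delta>)"
        using B by (rule weakening) auto
      ultimately have "der K L (insert A \<Gamma>) \<Delta>"
        using True by - (rule cut[of B], auto)
      then show ?thesis using A True by - (rule cut[of A], auto)
    next
      case False
      then show ?thesis using rconj.hyps(1) rconj.prems(1) A B by (blast intro: der.rconj)
    qed
  next
    case (ldisj A B \<Gamma> \<Delta>\<^sub>0)
    have "der K L (insert A \<Gamma>) \<Delta>" "der K L (insert B \<Gamma>) \<Delta>"
      by (rule ldisj.IH; use ldisj.prems in \<open>auto intro: grow\<close>)+
    then show ?case using ldisj.hyps by (blast intro: der.ldisj)
  next
    case (rdisj A B \<Delta>\<^sub>0 \<Gamma>)
    have AB: "der K L \<Gamma> (insert A (insert B \<Delta>))"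
      by (rule rdisj.IH) (use rdisj.prems in \<open>auto intro: grow\<close>)
    show ?case
    proof (cases "C = Disj A B")
      case True
      then have "der K L (insert A \<Gamma>) \<Delta>" and B: "der K L (insert B \<Gamma>) \<Delta>"
        using rdisj.prems(2) by (auto intro: invert_left_Disj)
      then have "der K L (insert A \<Gamma>) (insert B \<Delta>)"
        by (auto elim: weakening)
      then have "der K L \<Gamma> (insert B \<Delta>)"
        using AB True by - (rule cut[of A], auto)
      then show ?thesis using B True by - (rule cut[of B], auto)
    next
      case False
      then show ?thesis using rdisj.hyps(1) rdisj.prems(1) AB by (blast intro: der.rdisj)
    qed
  next
    case (limp A B \<Gamma> \<Delta>\<^sub>0)
    have "der K L \<Gamma> (insert A \<Delta>)" "der K L (insert B \<Gamma>) \<Delta>"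
      by (rule limp.IH; use limp.prems in \<open>auto intro: grow\<close>)+
    then show ?case using limp.hyps by (blast intro: der.limp)
  next
    case (rimp A B \<Delta>\<^sub>0 \<Gamma>)
    have prem: "der K L (insert A \<Gamma>) (insert B (side K \<Delta>))"
    proof (cases "K = Classical")
      case True
      have [simp]: "side K \<Delta> = \<Delta>" for \<Delta>
        using True by (simp add: side_def)
      show ?thesis
        by (rule rimp.IH) (use rimp.prems in \<open>auto intro: grow\<close>)
    next
      case False
      then show ?thesis using rimp.hyps(2) by (simp add: side_def)
    qed
    show ?case
    proof (cases "C = Imp A B")
      case True
      show ?thesis
        using rimp.prems(2)
      proof (rule cut_right_principal
          [where C = C and prem = "\<lambda>\<Gamma> \<Delta>. der K L (insert A \<Gamma>) (insert B (side K \<Delta>))"])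
        fix \<Gamma> \<Delta> \<Gamma>' \<Delta>'
        assume "der K L (insert A \<Gamma>) (insert B (side K \<Delta>))" "\<Gamma> \<subseteq> \<Gamma>'" "side K \<Delta> \<subseteq> side K \<Delta>'"
        then show "der K L (insert A \<Gamma>') (insert B (side K \<Delta>'))"
          by (elim weakening) auto
      next
        fix A' B' \<Gamma> \<Delta>
        assume "C = Imp A' B'" and prem: "der K L (insert A \<Gamma>) (insert B (side K \<Delta>))"
          and A: "der K L \<Gamma> (insert A' \<Delta>)" and B: "der K L (insert B' \<Gamma>) \<Delta>"
        then have [simp]: "A' = A" "B' = B" using True by auto
        have "der K L (insert A \<Gamma>) (insert B \<Delta>)"
          using prem by (rule weakening) (use side_subset in auto)
        moreover have "der K L (insert B (insert A \<Gamma>)) \<Delta>"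
          using B by (rule weakening) auto
        ultimately have "der K L (insert A \<Gamma>) \<Delta>"
          using True by - (rule cut[of B], auto)
        then show "der K L \<Gamma> \<Delta>" using A True by - (rule cut[of A], auto)
      qed (use True prem in auto)
    next
      case False
      then show ?thesis using rimp.hyps(1) rimp.prems(1) prem by (blast intro: der.rimp)
    qed
  next
    case (lall x A \<Gamma> t \<Delta>\<^sub>0)
    have "der K L (insert (A\<langle>Bound x/t\<rangle>) \<Gamma>) \<Delta>"
      by (rule lall.IH) (use lall.prems in \<open>auto intro: grow\<close>)
    then show ?case using lall.hyps by (blast intro: der.lall)
  next
    case (rall x A \<Delta>\<^sub>0 \<Gamma>)
    have prem: "der K L \<Gamma> (insert (A\<langle>Bound x/t\<rangle>) (side K \<Delta>))" if t: "is_term L t" for t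
    proof (cases "K = Classical")
      case True
      have [simp]: "side K \<Delta> = \<Delta>" for \<Delta>
        using True by (simp add: side_def)
      show ?thesis
        by (rule rall.IH[OF t]) (use rall.prems in \<open>auto intro: grow\<close>)
    next
      case False
      then show ?thesis using rall.hyps(2)[OF t] by (simp add: side_def)
    qed
    show ?case
    proof (cases "C = All x A")
      case True
      show ?thesis
        using rall.prems(2)
      proof (rule cut_right_principal[where C = C and
            prem = "\<lambda>\<Gamma> \<Delta>. \<forall>t. is_term L t \<longrightarrow> der K L \<Gamma> (insert (A\<langle>Bound x/t\<rangle>) (side K \<Delta>))"])
        fix \<Gamma> \<Delta> \<Gamma>' \<Delta>'
        assume "\<forall>t. is_term L t \<longrightarrow> der K L \<Gamma> (insert (A\<langle>Bound x/t\<rangle>) (side K \<Delta>))"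
          "\<Gamma> \<subseteq> \<Gamma>'" "side K \<Delta> \<subseteq> side K \<Delta>'"
        then show "\<forall>t. is_term L t \<longrightarrow> der K L \<Gamma>' (insert (A\<langle>Bound x/t\<rangle>) (side K \<Delta>'))"
          by (meson insert_mono weakening)
      next
        fix x' A' t \<Gamma> \<Delta>
        assume "C = All x' A'" and t: "is_term L t"
          and prem: "\<forall>t. is_term L t \<longrightarrow> der K L \<Gamma> (insert (A\<langle>Bound x/t\<rangle>) (side K \<Delta>))"
          and A: "der K L (insert (A'\<langle>Bound x'/t\<rangle>) \<Gamma>) \<Delta>"
        then have [simp]: "x' = x" "A' = A" using True by auto
        have "der K L \<Gamma> (insert (A\<langle>Bound x/t\<rangle>) \<Delta>)"
          using prem[rule_format, OF t] by (rule weakening) (use side_subset in auto)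
        then show "der K L \<Gamma> \<Delta>" using A True by - (rule cut[of "A\<langle>Bound x/t\<rangle>"], auto)
      qed (use True prem in auto)
    next
      case False
      then show ?thesis using rall.hyps(1) rall.prems(1) prem by (blast intro: der.rall)
    qed
  next
    case (lex x A \<Gamma> \<Delta>\<^sub>0)
    have "der K L (insert (A\<langle>Bound x/t\<rangle>) \<Gamma>) \<Delta>" if "is_term L t" for t
      by (rule lex.IH[OF that]) (use lex.prems in \<open>auto intro: grow\<close>)
    then show ?case using lex.hyps by (blast intro: der.lex)
  next
    case (rex x A \<Delta>\<^sub>0 t \<Gamma>)
    have A: "der K L \<Gamma> (insert (A\<langle>Bound x/t\<rangle>) \<Delta>)"
      by (rule rex.IH) (use rex.prems in \<open>auto intro: grow\<close>)
    show ?case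
    proof (cases "C = Ex x A")
      case True
      then have "der K L (insert (A\<langle>Bound x/t\<rangle>) \<Gamma>) \<Delta>"
        using rex.prems(2) rex.hyps(2) invert_left_Ex by blast
      then show ?thesis using A True by - (rule cut[of "A\<langle>Bound x/t\<rangle>"], auto)
    next
      case False
      then show ?thesis using rex.hyps(1,2) rex.prems(1) A by (blast intro: der.rex)
    qed
  }
qed

theorem cut: "der K L \<Gamma> (insert C \<Delta>) \<Longrightarrow> der K L (insert C \<Gamma>) \<Delta> \<Longrightarrow> der K L \<Gamma> \<Delta>"
proof (induction "rank C" arbitrary: C \<Gamma> \<Delta> rule: less_induct)
  case less
  show ?case
    using less.prems(1) by (rule cut_left_step) (use less in auto)
qed

section \<open>From the given calculi to the cumulative calculus\<close>

definition calc :: "logic \<Rightarrow> ('f, 'p) lang \<Rightarrow> ('f, 'p) calculus" where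
  "calc K L = (case K of Minimal \<Rightarrow> G3m L | Intuitionistic \<Rightarrow> G3i L | Classical \<Rightarrow> G3c L)"

lemmas calc_simps = calc_def G3m_def G3i_def G3c_def

primrec der_inst :: "logic \<Rightarrow> ('f, 'p) lang \<Rightarrow> (nat \<Rightarrow> 'f tm) \<Rightarrow> ('f, 'p) sequent \<Rightarrow> bool" where
  "der_inst K L \<sigma> (\<Gamma> \<turnstile> \<Delta>) = der K L (inst \<sigma> ` set_mset \<Gamma>) (inst \<sigma> ` set_mset \<Delta>)"

lemma atomic_inst [simp]: "atomic (inst \<sigma> P) = atomic P"
  by (cases P) auto

lemma calc_cases:
  assumes "R \<in> calc K L"
  obtains "R = Init" | "R = LConj" | "R = RConj" | "R = LDisj" | "R = RDisj"
  | "R \<in> {LImp, LImp_i}" | "R = (if K = Classical then RImp else RImp_i)"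
  | "R = (if K = Minimal then InitBot else LBot)" | "R = LAll L"
  | "R = (if K = Classical then RAll else RAll_i)" | "R = LEx" | "R = REx L"
proof -
  have "R = Init \<or> R = LConj \<or> R = RConj \<or> R = LDisj \<or> R = RDisj
    \<or> R \<in> {LImp, LImp_i} \<or> R = (if K = Classical then RImp else RImp_i)
    \<or> R = (if K = Minimal then InitBot else LBot) \<or> R = LAll L
    \<or> R = (if K = Classical then RAll else RAll_i) \<or> R = LEx \<or> R = REx L"
    using assms by (cases K) (simp_all add: calc_simps, (elim disjE; simp)+)
  with that show thesis by metis
qed

text \<open>
  The claim is about all instances, since this turns an eigenvariable premiss into a family of
  premisses indexed by all terms: \<open>\<sigma>\<close> is changed at the eigenvariable only, which does not
  affect the conclusion. In an equality rule, the atom that occurs only in the premiss is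
  entailed by the conclusion, and \<open>cut_entailed\<close> removes it.
\<close>

lemma soundness:
  assumes "derivable L (calc K L \<union> {Ref, Rep, Rep1l, Rep2l}) S" "\<And>a. is_term L (\<sigma> a)"
  shows "der_inst K L \<sigma> S"
  using assms
proof (induction arbitrary: \<sigma> rule: derivable.induct)
  case (1 R ps c)
  have IH: "der_inst K L \<tau> p" if "p \<in> set ps" "\<And>a. is_term L (\<tau> a)" for p \<tau>
    using 1 that by blast
  note \<sigma> = "1.prems"
  have prems: "list_all (der_inst K L \<sigma>) ps"
    using IH \<sigma> by (simp add: list_all_iff)
  note inst_Bound = inst_subst_Bound[of L, OF \<sigma>]
  from 1(1) consider "R \<in> calc K L" | "R = Ref" | "R = Rep" | "R = Rep1l" | "R = Rep2l"
    by blast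
  then show ?case
  proof cases
    case 1
    then show ?thesis
    proof (cases rule: calc_cases)
      case 1
      with \<open>(ps, c) \<in> R\<close> obtain P \<Gamma> \<Delta>
        where "c = (add_mset P \<Gamma> \<turnstile> add_mset P \<Delta>)" "atomic P" by (auto simp: Init_def)
      then show ?thesis by (auto intro!: der.ax[of _ "inst \<sigma> P"] entails_member)
    next
      case 2
      with \<open>(ps, c) \<in> R\<close> obtain A B \<Gamma> \<Delta> where ps: "ps = [add_mset A (add_mset B \<Gamma>) \<turnstile> \<Delta>]"
        and c: "c = (add_mset (Conj A B) \<Gamma> \<turnstile> \<Delta>)" by (auto simp: LConj_def)
      show ?thesis
        using prems unfolding ps c der_inst.simps
        by - (rule der.lconj[of "inst \<sigma> A" "inst \<sigma> B"], auto elim: weakening)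
    next
      case 3
      with \<open>(ps, c) \<in> R\<close> obtain A B \<Gamma> \<Delta>
        where ps: "ps = [\<Gamma> \<turnstile> add_mset A \<Delta>, \<Gamma> \<turnstile> add_mset B \<Delta>]"
        and c: "c = (\<Gamma> \<turnstile> add_mset (Conj A B) \<Delta>)" by (auto simp: RConj_def)
      show ?thesis
        using prems unfolding ps c der_inst.simps
        by - (rule der.rconj[of "inst \<sigma> A" "inst \<sigma> B"], auto elim: weakening)
    next
      case 4
      with \<open>(ps, c) \<in> R\<close> obtain A B \<Gamma> \<Delta>
        where ps: "ps = [add_mset A \<Gamma> \<turnstile> \<Delta>, add_mset B \<Gamma> \<turnstile> \<Delta>]"
        and c: "c = (add_mset (Disj A B) \<Gamma> \<turnstile> \<Delta>)" by (auto simp: LDisj_def)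
      show ?thesis
        using prems unfolding ps c der_inst.simps
        by - (rule der.ldisj[of "inst \<sigma> A" "inst \<sigma> B"], auto elim: weakening)
    next
      case 5
      with \<open>(ps, c) \<in> R\<close> obtain A B \<Gamma> \<Delta> where ps: "ps = [\<Gamma> \<turnstile> add_mset A (add_mset B \<Delta>)]"
        and c: "c = (\<Gamma> \<turnstile> add_mset (Disj A B) \<Delta>)" by (auto simp: RDisj_def)
      show ?thesis
        using prems unfolding ps c der_inst.simps
        by - (rule der.rdisj[of "inst \<sigma> A" "inst \<sigma> B"], auto elim: weakening)
    next
      case 6
      with \<open>(ps, c) \<in> R\<close> obtain A B \<Gamma> \<Gamma>' \<Delta>
        where ps: "ps = [\<Gamma>' \<turnstile> add_mset A \<Delta>, add_mset B \<Gamma> \<turnstile> \<Delta>]"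
        and c: "c = (add_mset (Imp A B) \<Gamma> \<turnstile> \<Delta>)"
        and \<Gamma>': "set_mset \<Gamma>' \<subseteq> insert (Imp A B) (set_mset \<Gamma>)"
        by (fastforce simp: LImp_def LImp_i_def)
      have "inst \<sigma> ` set_mset \<Gamma>' \<subseteq> insert (Imp (inst \<sigma> A) (inst \<sigma> B)) (inst \<sigma> ` set_mset \<Gamma>)"
        using \<Gamma>' by fastforce
      then show ?thesis
        using prems unfolding ps c der_inst.simps
        by - (rule der.limp[of "inst \<sigma> A" "inst \<sigma> B"], auto elim: weakening)
    next
      case 7
      with \<open>(ps, c) \<in> R\<close> obtain A B \<Gamma> \<Delta>
        where ps: "ps = [add_mset A \<Gamma> \<turnstile> add_mset B (if K = Classical then \<Delta> else {#})]"
        and c: "c = (\<Gamma> \<turnstile> add_mset (Imp A B) \<Delta>)"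
        by (cases "K = Classical") (auto simp: RImp_def RImp_i_def)
      show ?thesis
        using prems unfolding ps c der_inst.simps
        by - (rule der.rimp[of "inst \<sigma> A" "inst \<sigma> B"],
            auto elim: weakening simp: side_def split: if_splits)
    next
      case 8
      with \<open>(ps, c) \<in> R\<close> show ?thesis
        by (auto simp: LBot_def InitBot_def intro!: der.bot split: if_splits)
    next
      case 9
      with \<open>(ps, c) \<in> R\<close> obtain A x t \<Gamma> \<Delta>
        where ps: "ps = [add_mset (A\<langle>Bound x/t\<rangle>) (add_mset (All x A) \<Gamma>) \<turnstile> \<Delta>]"
        and c: "c = (add_mset (All x A) \<Gamma> \<turnstile> \<Delta>)" and t: "is_term L t" by (auto simp: LAll_def)
      have "is_term L (inst_tm \<sigma> t)"
        using t \<sigma> by (auto simp: is_term_def intro: wf_inst_tm)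
      then show ?thesis
        using prems unfolding ps c der_inst.simps
        by - (rule der.lall[where x = x and A = "inst \<sigma> A" and t = "inst_tm \<sigma> t"],
            auto simp: inst_Bound)
    next
      case 10
      with \<open>(ps, c) \<in> R\<close> obtain A x a \<Gamma> \<Delta>
        where ps: "ps = [\<Gamma> \<turnstile> add_mset (A\<langle>Bound x/Var (Free a)\<rangle>) (if K = Classical then \<Delta> else {#})]"
        and c: "c = (\<Gamma> \<turnstile> add_mset (All x A) \<Delta>)"
        and a: "Free a \<notin> seq_vars (\<Gamma> \<turnstile> add_mset (All x A) \<Delta>)"
        by (cases "K = Classical") (auto simp: RAll_def RAll_i_def)
      show ?thesis
        unfolding c der_inst.simps
      proof (rule der.rall[of x "inst \<sigma> A"])
        fix t assume t: "is_term L t"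
        let ?\<tau> = "\<sigma>(a := t)"
        have "der_inst K L ?\<tau> (\<Gamma> \<turnstile> add_mset (A\<langle>Bound x/Var (Free a)\<rangle>)
            (if K = Classical then \<Delta> else {#}))"
          by (rule IH) (use ps \<sigma> t in auto)
        moreover have "inst ?\<tau> ` set_mset \<Gamma> = inst \<sigma> ` set_mset \<Gamma>"
          "inst ?\<tau> ` set_mset \<Delta> = inst \<sigma> ` set_mset \<Delta>"
          using a by (auto intro!: image_cong inst_cong)
        moreover have "inst ?\<tau> (A\<langle>Bound x/Var (Free a)\<rangle>) = (inst \<sigma> A)\<langle>Bound x/t\<rangle>"
          using a t \<sigma> by (auto intro: inst_subst_fresh)
        ultimately show "der K L (inst \<sigma> ` set_mset \<Gamma>) (insert ((inst \<sigma> A)\<langle>Bound x/t\<rangle>)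
            (side K (inst \<sigma> ` set_mset (add_mset (All x A) \<Delta>))))"
          by (auto elim: weakening simp: side_def)
      qed auto
    next
      case 11
      with \<open>(ps, c) \<in> R\<close> obtain A x a \<Gamma> \<Delta>
        where ps: "ps = [add_mset (A\<langle>Bound x/Var (Free a)\<rangle>) \<Gamma> \<turnstile> \<Delta>]"
        and c: "c = (add_mset (Ex x A) \<Gamma> \<turnstile> \<Delta>)"
        and a: "Free a \<notin> seq_vars (add_mset (Ex x A) \<Gamma> \<turnstile> \<Delta>)"
        by (auto simp: LEx_def)
      show ?thesis
        unfolding c der_inst.simps
      proof (rule der.lex[of x "inst \<sigma> A"])
        fix t assume t: "is_term L t"
        let ?\<tau> = "\<sigma>(a := t)"
        have "der_inst K L ?\<tau> (add_mset (A\<langle>Bound x/Var (Free a)\<rangle>) \<Gamma> \<turnstile> \<Delta>)"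
          by (rule IH) (use ps \<sigma> t in auto)
        moreover have "inst ?\<tau> ` set_mset \<Gamma> = inst \<sigma> ` set_mset \<Gamma>"
          "inst ?\<tau> ` set_mset \<Delta> = inst \<sigma> ` set_mset \<Delta>"
          using a by (auto intro!: image_cong inst_cong)
        moreover have "inst ?\<tau> (A\<langle>Bound x/Var (Free a)\<rangle>) = (inst \<sigma> A)\<langle>Bound x/t\<rangle>"
          using a t \<sigma> by (auto intro: inst_subst_fresh)
        ultimately show "der K L (insert ((inst \<sigma> A)\<langle>Bound x/t\<rangle>)
            (inst \<sigma> ` set_mset (add_mset (Ex x A) \<Gamma>))) (inst \<sigma> ` set_mset \<Delta>)"
          by (auto elim: weakening)
      qed auto
    next
      case 12
      with \<open>(ps, c) \<in> R\<close> obtain A x t \<Gamma> \<Delta>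
        where ps: "ps = [\<Gamma> \<turnstile> add_mset (Ex x A) (add_mset (A\<langle>Bound x/t\<rangle>) \<Delta>)]"
        and c: "c = (\<Gamma> \<turnstile> add_mset (Ex x A) \<Delta>)" and t: "is_term L t" by (auto simp: REx_def)
      have "is_term L (inst_tm \<sigma> t)"
        using t \<sigma> by (auto simp: is_term_def intro: wf_inst_tm)
      then show ?thesis
        using prems unfolding ps c der_inst.simps
        by - (rule der.rex[where x = x and A = "inst \<sigma> A" and t = "inst_tm \<sigma> t"],
            auto simp: inst_Bound insert_commute)
    qed
  next
    case 2
    with \<open>(ps, c) \<in> R\<close> obtain t \<Gamma> \<Delta> where ps: "ps = [add_mset (Eq t t) \<Gamma> \<turnstile> \<Delta>]"
      and c: "c = (\<Gamma> \<turnstile> \<Delta>)" by (auto simp: Ref_def)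
    show ?thesis
      using prems unfolding ps c der_inst.simps
      by - (rule cut_entailed[of K L "Eq (inst_tm \<sigma> t) (inst_tm \<sigma> t)"], auto intro: cong.refl)
  next
    case 3
    with \<open>(ps, c) \<in> R\<close> obtain s r P x \<Gamma> \<Delta> where P: "atomic P" and
      ps: "ps = [add_mset (Eq s r) (add_mset (P\<langle>Free x/s\<rangle>) (add_mset (P\<langle>Free x/r\<rangle>) \<Gamma>)) \<turnstile> \<Delta>]"
      and c: "c = (add_mset (Eq s r) (add_mset (P\<langle>Free x/s\<rangle>) \<Gamma>) \<turnstile> \<Delta>)"
      by (auto simp: Rep_def)
    show ?thesis
      using prems P unfolding ps c der_inst.simps
      by - (rule cut_entailed[of K L "inst \<sigma> (P\<langle>Free x/r\<rangle>)"],
          auto intro!: entails_inst_subst[of _ _ s] cong.base elim: weakening)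
  next
    case 4
    with \<open>(ps, c) \<in> R\<close> obtain s r P x \<Gamma> \<Delta> where P: "atomic P" and
      ps: "ps = [add_mset (Eq r s) (add_mset (P\<langle>Free x/r\<rangle>) \<Gamma>) \<turnstile> \<Delta>]"
      and c: "c = (add_mset (Eq r s) (add_mset (P\<langle>Free x/s\<rangle>) \<Gamma>) \<turnstile> \<Delta>)"
      by (auto simp: Rep1l_def)
    show ?thesis
      using prems P unfolding ps c der_inst.simps
      by - (rule cut_entailed[of K L "inst \<sigma> (P\<langle>Free x/r\<rangle>)"],
          auto intro!: entails_inst_subst[of _ _ s] cong.sym[OF cong.base] elim: weakening)
  next
    case 5
    with \<open>(ps, c) \<in> R\<close> obtain s r P x \<Gamma> \<Delta> where P: "atomic P" and
      ps: "ps = [add_mset (Eq s r) (add_mset (P\<langle>Free x/r\<rangle>) \<Gamma>) \<turnstile> \<Delta>]"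
      and c: "c = (add_mset (Eq s r) (add_mset (P\<langle>Free x/s\<rangle>) \<Gamma>) \<turnstile> \<Delta>)"
      by (auto simp: Rep2l_def)
    show ?thesis
      using prems P unfolding ps c der_inst.simps
      by - (rule cut_entailed[of K L "inst \<sigma> (P\<langle>Free x/r\<rangle>)"],
          auto intro!: entails_inst_subst[of _ _ s] cong.base elim: weakening)
  qed
qed

section \<open>Deriving the axioms by rewriting atoms\<close>

text \<open>
  The replacement rules substitute for a variable in an atom. Replacing a subterm at a given place
  is obtained from this by putting a fresh variable there, as the following lemmas show.
\<close>

definition atomic_context :: "('f tm \<Rightarrow> ('f, 'p) fm) \<Rightarrow> bool" where
  "atomic_context c \<longleftrightarrow> (\<exists>P x. atomic P \<and> c = (\<lambda>t. P\<langle>Free x/t\<rangle>))"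

lemma atomic_contextI: "atomic P \<Longrightarrow> (\<And>t. c t = P\<langle>Free x/t\<rangle>) \<Longrightarrow> atomic_context c"
  unfolding atomic_context_def by blast

lemma finite_vars_tm [simp]: "finite (vars_tm t)"
  by (induction t) auto

lemma finite_free_vars [simp]: "finite (free_vars F)"
  by (induction F) auto

lemma fresh_ex: "finite X \<Longrightarrow> \<exists>a. Free a \<notin> X"
  using finite_imageD[of Free UNIV] finite_subset[of "range Free" X] by (auto simp: inj_on_def)

lemma map_subst_tm_idle: "\<forall>t \<in> set ts. v \<notin> vars_tm t \<Longrightarrow> map (\<lambda>t. t\<langle>v/r\<rangle>\<^sub>t) ts = ts"
  by (auto simp: subst_tm_idle map_idI)

lemma atomic_context_Rel: "atomic_context (\<lambda>t. Rel p (ts @ t # us))"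
proof -
  obtain y where "Free y \<notin> (\<Union>t \<in> set (ts @ us). vars_tm t)"
    using fresh_ex by (metis List.finite_set finite_UN_I finite_vars_tm)
  then show ?thesis
    by (intro atomic_contextI[of "Rel p (ts @ Var (Free y) # us)" _ y])
      (auto simp: subst_tm_idle map_subst_tm_idle)
qed

lemma atomic_context_Eq_right: "atomic_context (\<lambda>t. Eq s t)"
proof -
  obtain y where "Free y \<notin> vars_tm s"
    using fresh_ex by (metis finite_vars_tm)
  then show ?thesis
    by (intro atomic_contextI[of "Eq s (Var (Free y))" _ y])
      (auto simp: subst_tm_idle map_subst_tm_idle)
qed

lemma atomic_context_Eq_left: "atomic_context (\<lambda>t. Eq t s)"
proof -
  obtain y where "Free y \<notin> vars_tm s"
    using fresh_ex by (metis finite_vars_tm)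
  then show ?thesis
    by (intro atomic_contextI[of "Eq (Var (Free y)) s" _ y])
      (auto simp: subst_tm_idle map_subst_tm_idle)
qed

lemma subst_tm_subst_tm:
  "v \<notin> vars_tm s \<Longrightarrow> s\<langle>w/r\<rangle>\<^sub>t\<langle>v/t\<rangle>\<^sub>t = s\<langle>w/r\<langle>v/t\<rangle>\<^sub>t\<rangle>\<^sub>t"
  by (induction s) auto

lemma atomic_context_Fn:
  assumes "atomic_context c"
  shows "atomic_context (\<lambda>t. c (Fn f (ts @ t # us)))"
proof -
  obtain P x where P: "atomic P" and c: "c = (\<lambda>t. P\<langle>Free x/t\<rangle>)"
    using assms by (auto simp: atomic_context_def)
  have "finite (free_vars P \<union> (\<Union>t \<in> set (ts @ us). vars_tm t))" by simp
  then obtain y where y: "Free y \<notin> free_vars P \<union> (\<Union>t \<in> set (ts @ us). vars_tm t)"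
    using fresh_ex by metis
  define P' where "P' = P\<langle>Free x/Fn f (ts @ Var (Free y) # us)\<rangle>"
  have "c (Fn f (ts @ t # us)) = P'\<langle>Free y/t\<rangle>" for t
    using P y by (cases P) (auto simp: c P'_def subst_tm_subst_tm map_subst_tm_idle)
  moreover have "atomic P'" using P by (cases P) (auto simp: P'_def)
  ultimately show ?thesis by (intro atomic_contextI)
qed

text \<open>
  Derivability is required for all larger antecedents since rewriting bottom-up by different rules
  leaves different atoms behind, and weakening is not yet available for the given calculi.
\<close>

definition closes :: "('f, 'p) lang \<Rightarrow> ('f, 'p) calculus \<Rightarrow> ('f, 'p) fm multiset \<Rightarrow>
    ('f, 'p) fm multiset \<Rightarrow> bool" where
  "closes L C \<Delta> M \<longleftrightarrow> (\<forall>\<Gamma>. M \<subseteq># \<Gamma> \<longrightarrow> is_sequent L (\<Gamma> \<turnstile> \<Delta>) \<longrightarrow> derivable L C (\<Gamma> \<turnstile> \<Delta>))"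

lemma derivable_by:
  assumes "R \<in> C" "(ps, c) \<in> R" "is_sequent L c" "\<And>p. p \<in> set ps \<Longrightarrow> derivable L C p"
  shows "derivable L C c"
  using assms derivable.intros by metis

lemma wf_subst_tm_swap: "wf_tm L B (t\<langle>v/s\<rangle>\<^sub>t) \<Longrightarrow> wf_tm L B r \<Longrightarrow> wf_tm L B (t\<langle>v/r\<rangle>\<^sub>t)"
  by (induction t) (auto simp: list_all_iff split: if_splits)

lemma wf_subst_swap:
  "atomic P \<Longrightarrow> is_formula L (P\<langle>v/s\<rangle>) \<Longrightarrow> is_term L r \<Longrightarrow> is_formula L (P\<langle>v/r\<rangle>)"
  by (cases P) (auto simp: is_formula_def is_term_def list_all_iff intro: wf_subst_tm_swap)

text \<open>
  The last assumption ensures that the premiss of \<open>Ref\<close> is a sequent of the language.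
\<close>

lemma closes_Ref:
  assumes "Ref \<in> C" "closes L C \<Delta> (add_mset (Eq t t) M)"
    and "is_sequent L (M \<turnstile> \<Delta>) \<Longrightarrow> is_term L t"
  shows "closes L C \<Delta> M"
  unfolding closes_def
proof (intro allI impI)
  fix \<Gamma> assume M: "M \<subseteq># \<Gamma>" and wf: "is_sequent L (\<Gamma> \<turnstile> \<Delta>)"
  have "is_sequent L (M \<turnstile> \<Delta>)"
    using wf mset_subset_eqD[OF M] by auto
  then have "is_sequent L (add_mset (Eq t t) \<Gamma> \<turnstile> \<Delta>)"
    using wf assms(3) by (auto simp: is_formula_def is_term_def)
  then have "derivable L C (add_mset (Eq t t) \<Gamma> \<turnstile> \<Delta>)"
    using assms(2) M by (simp add: closes_def)
  then show "derivable L C (\<Gamma> \<turnstile> \<Delta>)"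
    using wf assms(1)
    by - (rule derivable_by[of Ref C "[add_mset (Eq t t) \<Gamma> \<turnstile> \<Delta>]"], auto simp: Ref_def)
qed

lemma closes_rewrite_forward:
  assumes "Rep \<in> C \<or> Rep2l \<in> C" "Eq s r \<in># M" "atomic_context c" "closes L C \<Delta> (add_mset (c r) M)"
  shows "closes L C \<Delta> (add_mset (c s) M)"
  unfolding closes_def
proof (intro allI impI)
  fix \<Gamma> assume sub: "add_mset (c s) M \<subseteq># \<Gamma>" and wf: "is_sequent L (\<Gamma> \<turnstile> \<Delta>)"
  obtain M' where M: "M = add_mset (Eq s r) M'" using assms(2) by (metis multi_member_split)
  obtain N where \<Gamma>: "\<Gamma> = add_mset (Eq s r) (add_mset (c s) (M' + N))"
    using sub by (auto simp: M subset_mset.le_iff_add)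
  obtain P x where P: "atomic P" and c: "c = (\<lambda>t. P\<langle>Free x/t\<rangle>)"
    using assms(3) by (auto simp: atomic_context_def)
  have "is_formula L (c s)" "is_term L r"
    using wf by (auto simp: \<Gamma> is_formula_def is_term_def)
  then have wf_r: "is_formula L (c r)"
    using P by (auto simp: c intro: wf_subst_swap)
  \<comment> \<open>\<open>N'\<close> is the rewritten atom, which \<open>Rep\<close> keeps and \<open>Rep2l\<close> loses.\<close>
  have prem: "derivable L C (add_mset (Eq s r) (N' + add_mset (c r) (M' + N)) \<turnstile> \<Delta>)"
    if "N' \<subseteq># {#c s#}" for N'
  proof -
    have "add_mset (c r) M \<subseteq># add_mset (Eq s r) (N' + add_mset (c r) (M' + N))"
      by (simp add: M)
    moreover have "is_sequent L (add_mset (Eq s r) (N' + add_mset (c r) (M' + N)) \<turnstile> \<Delta>)"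
      using wf wf_r mset_subset_eqD[OF that] by (auto simp: \<Gamma>)
    ultimately show ?thesis
      using assms(4) by (simp add: closes_def)
  qed
  show "derivable L C (\<Gamma> \<turnstile> \<Delta>)"
    using assms(1)
  proof
    assume "Rep \<in> C"
    have "([add_mset (Eq s r) (add_mset (P\<langle>Free x/s\<rangle>)
          (add_mset (P\<langle>Free x/r\<rangle>) (M' + N))) \<turnstile> \<Delta>], \<Gamma> \<turnstile> \<Delta>) \<in> Rep"
      using P unfolding Rep_def \<Gamma> c by blast
    from derivable_by[OF \<open>Rep \<in> C\<close> this wf] prem[of "{#c s#}"] show ?thesis
      by (simp add: c add_mset_commute)
  next
    assume "Rep2l \<in> C"
    have "([add_mset (Eq s r)
          (add_mset (P\<langle>Free x/r\<rangle>) (M' + N)) \<turnstile> \<Delta>], \<Gamma> \<turnstile> \<Delta>) \<in> Rep2l"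
      using P unfolding Rep2l_def \<Gamma> c by blast
    from derivable_by[OF \<open>Rep2l \<in> C\<close> this wf] prem[of "{#}"] show ?thesis
      by (simp add: c add_mset_commute)
  qed
qed

lemma closes_rewrite_backward:
  assumes "Rep1l \<in> C" "Eq s r \<in># M" "atomic_context c" "closes L C \<Delta> (add_mset (c s) M)"
  shows "closes L C \<Delta> (add_mset (c r) M)"
  unfolding closes_def
proof (intro allI impI)
  fix \<Gamma> assume sub: "add_mset (c r) M \<subseteq># \<Gamma>" and wf: "is_sequent L (\<Gamma> \<turnstile> \<Delta>)"
  obtain M' where M: "M = add_mset (Eq s r) M'" using assms(2) by (metis multi_member_split)
  obtain N where \<Gamma>: "\<Gamma> = add_mset (Eq s r) (add_mset (c r) (M' + N))"
    using sub by (auto simp: M subset_mset.le_iff_add)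
  obtain P x where P: "atomic P" and c: "c = (\<lambda>t. P\<langle>Free x/t\<rangle>)"
    using assms(3) by (auto simp: atomic_context_def)
  have "is_formula L (c r)" "is_term L s"
    using wf by (auto simp: \<Gamma> is_formula_def is_term_def)
  then have "is_formula L (c s)"
    using P by (auto simp: c intro: wf_subst_swap)
  then have prem: "derivable L C (add_mset (Eq s r) (add_mset (c s) (M' + N)) \<turnstile> \<Delta>)"
    using assms(4) wf by (auto simp: closes_def \<Gamma> M)
  have "([add_mset (Eq s r)
        (add_mset (P\<langle>Free x/s\<rangle>) (M' + N)) \<turnstile> \<Delta>], \<Gamma> \<turnstile> \<Delta>) \<in> Rep1l"
    using P unfolding Rep1l_def \<Gamma> c by blast
  from derivable_by[OF assms(1) this wf] prem show "derivable L C (\<Gamma> \<turnstile> \<Delta>)" by (simp add: c)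
qed

lemma is_term_of_Eq:
  "Eq s r \<in># M \<Longrightarrow> is_sequent L (M \<turnstile> \<Delta>) \<Longrightarrow> is_term L s \<and> is_term L r"
  by (drule multi_member_split) (auto simp: is_formula_def is_term_def)

text \<open>
  An equation \<open>s = r\<close> in the antecedent may be joined by \<open>r = s\<close>: add \<open>t = t\<close> by \<open>Ref\<close> and
  rewrite one side of it. With \<open>Rep1l\<close> the term \<open>t\<close> is \<open>r\<close>, whose right occurrence becomes \<open>s\<close>;
  with the other rules it is \<open>s\<close>, whose left occurrence becomes \<open>r\<close>.
\<close>

lemma closes_reverse_Eq:
  assumes "Ref \<in> C" "C \<inter> {Rep, Rep1l, Rep2l} \<noteq> {}" "Eq s r \<in># M"
    and "closes L C \<Delta> (add_mset (Eq r s) M)"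
  shows "closes L C \<Delta> M"
proof (cases "Rep1l \<in> C")
  case True
  then have "closes L C \<Delta> (add_mset (Eq r r) M)"
    using closes_rewrite_backward[OF _ assms(3) atomic_context_Eq_right] assms(4) by blast
  then show ?thesis
    using assms(1,3) by - (rule closes_Ref, auto dest: is_term_of_Eq)
next
  case False
  then have "closes L C \<Delta> (add_mset (Eq s s) M)"
    using closes_rewrite_forward[OF _ assms(3) atomic_context_Eq_left] assms(2,4) by blast
  then show ?thesis
    using assms(1,3) by - (rule closes_Ref, auto dest: is_term_of_Eq)
qed

lemma closes_mono: "closes L C \<Delta> M \<Longrightarrow> M \<subseteq># N \<Longrightarrow> closes L C \<Delta> N"
  unfolding closes_def by (meson subset_mset.order_trans)

lemma closes_rewrite:
  assumes C: "Ref \<in> C" "C \<inter> {Rep, Rep1l, Rep2l} \<noteq> {}" and M: "Eq s r \<in># M" and c: "atomic_context c"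
  shows "closes L C \<Delta> (add_mset (c s) M) \<longleftrightarrow> closes L C \<Delta> (add_mset (c r) M)"
proof -
  let ?N = "add_mset (Eq r s) M"
  have reverse: "closes L C \<Delta> (add_mset (c t) ?N) \<longleftrightarrow> closes L C \<Delta> (add_mset (c t) M)" for t
  proof
    assume "closes L C \<Delta> (add_mset (c t) ?N)"
    then show "closes L C \<Delta> (add_mset (c t) M)"
      using closes_reverse_Eq[OF C, of s r "add_mset (c t) M"] M by (simp add: add_mset_commute)
  qed (auto elim: closes_mono)
  from C(2) consider "Rep \<in> C \<or> Rep2l \<in> C" | "Rep1l \<in> C" by auto
  then show ?thesis
  proof cases
    case 1
    show ?thesis
      using closes_rewrite_forward[OF 1 M c, of L \<Delta>] reverse[of s] reverse[of r]
        closes_rewrite_forward[OF 1 _ c, of r s ?N L \<Delta>] by auto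
  next
    case 2
    show ?thesis
      using closes_rewrite_backward[OF 2 M c, of L \<Delta>] reverse[of s] reverse[of r]
        closes_rewrite_backward[OF 2 _ c, of r s ?N L \<Delta>] by auto
  qed
qed

text \<open>
  The equations of \<open>M\<close> are not touched, because the atom that is rewritten stands next to \<open>M\<close>.
\<close>

lemma closes_cong:
  assumes C: "Ref \<in> C" "C \<inter> {Rep, Rep1l, Rep2l} \<noteq> {}" and "cong (set_mset M) t u" "atomic_context c"
  shows "closes L C \<Delta> (add_mset (c t) M) \<longleftrightarrow> closes L C \<Delta> (add_mset (c u) M)"
  using assms(3,4)
proof (induction arbitrary: c rule: cong.induct)
  case (base s r)
  then show ?case using closes_rewrite[OF C] by blast
next
  case (Fn ts us f)
  \<comment> \<open>The arguments are exchanged one at a time; \<open>vs\<close> are those already done.\<close>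
  have "closes L C \<Delta> (add_mset (c (Fn f (vs @ ts))) M) \<longleftrightarrow>
      closes L C \<Delta> (add_mset (c (Fn f (vs @ us))) M)" for vs
    using Fn.IH
  proof (induction arbitrary: vs rule: list_all2_induct)
    case (Cons t ts u us)
    have "closes L C \<Delta> (add_mset (c (Fn f (vs @ t # ts))) M) \<longleftrightarrow>
        closes L C \<Delta> (add_mset (c (Fn f (vs @ u # ts))) M)"
      using Cons.hyps(1) atomic_context_Fn[OF Fn.prems, of f vs ts] by blast
    then show ?case using Cons.IH[of "vs @ [u]"] by simp
  qed simp
  from this[of "[]"] show ?case by simp
qed auto

lemma closes_cong_list:
  assumes C: "Ref \<in> C" "C \<inter> {Rep, Rep1l, Rep2l} \<noteq> {}" and "list_all2 (cong (set_mset M)) ts us"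
  shows "closes L C \<Delta> (add_mset (Rel p (vs @ ts)) M) \<longleftrightarrow>
    closes L C \<Delta> (add_mset (Rel p (vs @ us)) M)"
  using assms(3)
proof (induction arbitrary: vs rule: list_all2_induct)
  case (Cons t ts u us)
  then show ?case
    using closes_cong[OF C _ atomic_context_Rel, of M t u L \<Delta> p vs ts] Cons.IH[of "vs @ [u]"]
    by simp
qed simp

text \<open>
  An entailed equation \<open>t = u\<close> is reached from \<open>t = t\<close>, added by \<open>Ref\<close>. An entailed \<open>Rel p ts\<close> is
  reached from an atom of \<open>\<Gamma>\<close> which may be used up, since it is not an equation.
\<close>

lemma derivable_entailed:
  assumes C: "Ref \<in> C" "C \<inter> {Rep, Rep1l, Rep2l} \<noteq> {}" "Init \<in> C"
    and "entails (set_mset \<Gamma>) P" "P \<in># \<Delta>" "is_sequent L (\<Gamma> \<turnstile> \<Delta>)"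
  shows "derivable L C (\<Gamma> \<turnstile> \<Delta>)"
proof -
  have P: "closes L C \<Delta> (add_mset P M)" for M
    unfolding closes_def
  proof (intro allI impI)
    fix N assume "add_mset P M \<subseteq># N" and wf: "is_sequent L (N \<turnstile> \<Delta>)"
    then obtain N' \<Delta>' where N: "N = add_mset P N'" and \<Delta>: "\<Delta> = add_mset P \<Delta>'"
      using assms(5) by (metis mset_subset_eqD multi_member_split union_single_eq_member)
    show "derivable L C (N \<turnstile> \<Delta>)"
      using C(3) wf entails_atomic[OF assms(4)] unfolding N \<Delta>
      by - (rule derivable_by[of Init C "[]"], auto simp: Init_def)
  qed
  have "closes L C \<Delta> \<Gamma>"
  proof (cases P)
    case (Rel p ts)
    then obtain us where us: "Rel p us \<in># \<Gamma>" "list_all2 (cong (set_mset \<Gamma>)) us ts"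
      using assms(4) by auto
    then obtain \<Gamma>' where \<Gamma>: "\<Gamma> = add_mset (Rel p us) \<Gamma>'" by (metis multi_member_split)
    have "list_all2 (cong (set_mset \<Gamma>')) us ts"
      using us(2) by (rule list_all2_mono) (auto elim!: cong_cut intro: cong.base simp: \<Gamma>)
    then show ?thesis
      using closes_cong_list[OF C(1,2), of \<Gamma>' us ts L \<Delta> p "[]"] P Rel \<Gamma> by simp
  next
    case (Eq t u)
    then have "closes L C \<Delta> (add_mset (Eq t t) \<Gamma>)"
      using closes_cong[OF C(1,2) _ atomic_context_Eq_right, of \<Gamma> t u] assms(4) P by simp
    then show ?thesis
      using C(1) assms(5) Eq
      by - (rule closes_Ref, auto simp: is_formula_def is_term_def dest!: multi_member_split)
  qed (use entails_atomic[OF assms(4)] in auto)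
  then show ?thesis using assms(6) by (simp add: closes_def)
qed

section \<open>From the cumulative calculus to the given calculi\<close>

lemma wf_tm_mono: "wf_tm L B t \<Longrightarrow> B \<subseteq> B' \<Longrightarrow> wf_tm L B' t"
proof (induction t)
  case (Var v)
  then show ?case by (cases v) auto
qed (auto simp: list_all_iff)

lemma wf_subst_tm_Bound:
  "wf_tm L (insert x B) s \<Longrightarrow> is_term L t \<Longrightarrow> wf_tm L B (s\<langle>Bound x/t\<rangle>\<^sub>t)"
proof (induction s)
  case (Var v)
  then show ?case by (cases v) (auto simp: is_term_def elim: wf_tm_mono)
qed (auto simp: list_all_iff)

lemma wf_subst_Bound:
  "wf_fm L (insert x B) F \<Longrightarrow> is_term L t \<Longrightarrow> wf_fm L B (F\<langle>Bound x/t\<rangle>)"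
  by (induction F arbitrary: B)
    (auto simp: list_all_iff insert_commute intro: wf_subst_tm_Bound)

definition covers :: "logic \<Rightarrow> ('f, 'p) lang \<Rightarrow> ('f, 'p) fm multiset \<Rightarrow> ('f, 'p) fm multiset \<Rightarrow>
    ('f, 'p) fm set \<Rightarrow> ('f, 'p) fm set \<Rightarrow> bool" where
  "covers K L G D \<Gamma> \<Delta> \<longleftrightarrow> (\<forall>F \<in> \<Gamma>. absorbs_left K L (set_mset G) (set_mset D) F)
    \<and> (\<forall>F \<in> \<Delta>. absorbs_right K L (set_mset G) (set_mset D) F)"

text \<open>
  If an inference replaces \<open>G \<turnstile> D\<close> by a premiss that covers it, everything covered so far
  remains covered.
\<close>

lemma covers_trans:
  assumes "covers K L G D \<Gamma> \<Delta>" "covers K L G' D' (set_mset G) (set_mset D)"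
  shows "covers K L G' D' \<Gamma> \<Delta>"
  using assms absorbs_trans[of "set_mset G" K L "set_mset G'" "set_mset D'" "set_mset D"]
  unfolding covers_def by blast

lemma covers_left_nonclassical:
  assumes "K \<noteq> Classical" "covers K L G D \<Gamma> \<Delta>" "G \<subseteq># G'" "\<And>F. F \<in> \<Delta>' \<Longrightarrow> F \<in># D'"
  shows "covers K L G' D' \<Gamma> \<Delta>'"
  unfolding covers_def
proof safe
  fix F assume "F \<in> \<Gamma>"
  then have "absorbs_left K L (set_mset G) (set_mset D) F"
    using assms(2) by (auto simp: covers_def)
  then show "absorbs_left K L (set_mset G') (set_mset D') F"
    by (rule absorbs_left_trans_nonclassical(1)[OF assms(1), rotated])
      (use mset_subset_eqD[OF assms(3)] in \<open>auto intro: absorbs_left_absorbs_right.left\<close>)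
qed (auto intro: absorbs_left_absorbs_right.right assms(4))

lemma covers_insert_left:
  "covers K L G D (insert F \<Gamma>) \<Delta> \<longleftrightarrow>
    absorbs_left K L (set_mset G) (set_mset D) F \<and> covers K L G D \<Gamma> \<Delta>"
  by (auto simp: covers_def)

lemma covers_insert_right:
  "covers K L G D \<Gamma> (insert F \<Delta>) \<longleftrightarrow>
    absorbs_right K L (set_mset G) (set_mset D) F \<and> covers K L G D \<Gamma> \<Delta>"
  by (auto simp: covers_def)

inductive_cases absorbs_right_ConjE: "absorbs_right K L \<Gamma> \<Delta> (Conj A B)"
inductive_cases absorbs_right_DisjE: "absorbs_right K L \<Gamma> \<Delta> (Disj A B)"
inductive_cases absorbs_right_ImpE: "absorbs_right K L \<Gamma> \<Delta> (Imp A B)"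
inductive_cases absorbs_right_ExE: "absorbs_right K L \<Gamma> \<Delta> (Ex x A)"
inductive_cases absorbs_right_AllE: "absorbs_right K L \<Gamma> \<Delta> (All x A)"
inductive_cases absorbs_right_BotE: "absorbs_right K L \<Gamma> \<Delta> Bot"

lemma absorbs_right_atomic: "atomic P \<Longrightarrow> absorbs_right K L \<Gamma> \<Delta> P \<Longrightarrow> P \<in> \<Delta>"
  by (erule absorbs_right.cases) auto

lemma fresh_for_sequent: "\<exists>a. Free a \<notin> seq_vars (\<Gamma> \<turnstile> \<Delta>)"
  by (rule fresh_ex) simp

lemma derivable_by1:
  assumes "R \<in> C" "([p], c) \<in> R" "is_sequent L c" "derivable L C p"
  shows "derivable L C c"
  using assms by (auto intro: derivable_by)

lemma derivable_by2:
  assumes "R \<in> C" "([p, q], c) \<in> R" "is_sequent L c" "derivable L C p" "derivable L C q"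
  shows "derivable L C c"
  using assms by (auto intro: derivable_by)

text \<open>
  For each inference of \<open>der\<close>, its principal formula is covered. If it occurs in the multiset
  sequent, the corresponding rule is applied, and the premisses cover the formula that the rule
  consumed. Otherwise it has been decomposed already, the multiset sequent covers one of the
  premisses of the inference as it stands, and nothing has to be applied. In this way a formula
  that is principal repeatedly in \<open>der\<close> need not be contracted.
\<close>

theorem completeness:
  assumes "der K L \<Gamma> \<Delta>" "calc K L \<subseteq> C" "Ref \<in> C" "C \<inter> {Rep, Rep1l, Rep2l} \<noteq> {}"
    and "covers K L G D \<Gamma> \<Delta>" "is_sequent L (G \<turnstile> D)"
  shows "derivable L C (G \<turnstile> D)"
  using assms(1,5,6)
proof (induction arbitrary: G D rule: der.induct)
  have rules: "Init \<in> C" "LConj \<in> C" "RConj \<in> C" "LDisj \<in> C" "RDisj \<in> C"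
    "LAll L \<in> C" "LEx \<in> C" "REx L \<in> C" "K = Minimal \<Longrightarrow> InitBot \<in> C" "K \<noteq> Minimal \<Longrightarrow> LBot \<in> C"
    "K = Classical \<Longrightarrow> LImp \<in> C" "K = Classical \<Longrightarrow> RImp \<in> C" "K = Classical \<Longrightarrow> RAll \<in> C"
    "K \<noteq> Classical \<Longrightarrow> LImp_i \<in> C" "K \<noteq> Classical \<Longrightarrow> RImp_i \<in> C" "K \<noteq> Classical \<Longrightarrow> RAll_i \<in> C"
    using assms(2) by (cases K; simp add: calc_simps)+
  note absorb = absorbs_left_absorbs_right.intros
  have classical: "side K \<Delta> = \<Delta>" if "K = Classical" for \<Delta>
    using that by (simp add: side_def)
  have nonclassical: "side K \<Delta> = {}" if "K \<noteq> Classical" for \<Delta>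
    using that by (simp add: side_def)
  {
    case (ax \<Gamma> P \<Delta>)
    have "entails (set_mset G) P"
      using ax.hyps(1) ax.prems(1) by (auto simp: covers_def elim: absorbs_left_entailed)
    moreover have "P \<in># D"
      using entails_atomic[OF ax.hyps(1)] ax.hyps(2) ax.prems(1)
      by (auto simp: covers_def intro: absorbs_right_atomic)
    ultimately show ?case
      using assms(3,4) rules(1) ax.prems(2) by (intro derivable_entailed)
  next
    case (bot \<Gamma> \<Delta>)
    have "Bot \<in># G"
      using bot.hyps(1) bot.prems(1) by (auto simp: covers_def elim!: absorbs_left_BotE)
    then obtain G' where G: "G = add_mset Bot G'" by (metis multi_member_split)
    show ?case
    proof (cases "K = Minimal")
      case True
      then have "Bot \<in># D"
        using bot.hyps(2) bot.prems(1) by (auto simp: covers_def elim!: absorbs_right_BotE)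
      then obtain D' where D: "D = add_mset Bot D'" by (metis multi_member_split)
      have "([], G \<turnstile> D) \<in> InitBot" unfolding InitBot_def G D by blast
      with True bot.prems(2) show ?thesis by (auto intro: derivable_by rules)
    next
      case False
      have "([], G \<turnstile> D) \<in> LBot" unfolding LBot_def G by blast
      with False bot.prems(2) show ?thesis by (auto intro: derivable_by rules)
    qed
  next
    case (lconj A B \<Gamma> \<Delta>)
    have "absorbs_left K L (set_mset G) (set_mset D) (Conj A B)"
      using lconj.hyps(1) lconj.prems(1) by (auto simp: covers_def)
    then show ?case
    proof (rule absorbs_left_ConjE)
      assume "Conj A B \<in># G"
      then obtain G' where G: "G = add_mset (Conj A B) G'" by (metis multi_member_split)
      let ?G = "add_mset A (add_mset B G')"
      have "covers K L ?G D (set_mset G) (set_mset D)"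
        by (auto simp: covers_def G intro: absorb)
      then have "covers K L ?G D (insert A (insert B \<Gamma>)) \<Delta>"
        using covers_trans[OF lconj.prems(1)] by (auto simp: covers_insert_left intro: absorb)
      then have "derivable L C (?G \<turnstile> D)"
        by (rule lconj.IH) (use lconj.prems(2) in \<open>auto simp: G is_formula_def\<close>)
      moreover have "([?G \<turnstile> D], G \<turnstile> D) \<in> LConj" unfolding LConj_def G by blast
      ultimately show ?thesis using lconj.prems(2) by (auto intro: derivable_by1 rules)
    qed (use lconj.IH lconj.prems in \<open>auto simp: covers_insert_left\<close>)
  next
    case (rconj A B \<Delta> \<Gamma>)
    have "absorbs_right K L (set_mset G) (set_mset D) (Conj A B)"
      using rconj.hyps(1) rconj.prems(1) by (auto simp: covers_def)
    then show ?case
    proof (rule absorbs_right_ConjE)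
      assume "Conj A B \<in># D"
      then obtain D' where D: "D = add_mset (Conj A B) D'" by (metis multi_member_split)
      have "covers K L G (add_mset E D') (set_mset G) (set_mset D)" if "E \<in> {A, B}" for E
        using that by (auto simp: covers_def D intro: absorb)
      then have "covers K L G (add_mset E D') \<Gamma> (insert E \<Delta>)" if "E \<in> {A, B}" for E
        using that covers_trans[OF rconj.prems(1)] by (auto simp: covers_insert_right intro: absorb)
      then have "derivable L C (G \<turnstile> add_mset A D')" "derivable L C (G \<turnstile> add_mset B D')"
        using rconj.IH(1)[of G "add_mset A D'"]
          rconj.IH(2)[of G "add_mset B D'"] rconj.prems(2)
        by (auto simp: D is_formula_def)
      moreover have "([G \<turnstile> add_mset A D', G \<turnstile> add_mset B D'], G \<turnstile> D) \<in> RConj"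
        unfolding RConj_def D by blast
      ultimately show ?thesis using rconj.prems(2) by (auto intro: derivable_by2 rules)
    qed (use rconj.IH rconj.prems in \<open>auto simp: covers_insert_right\<close>)
  next
    case (ldisj A B \<Gamma> \<Delta>)
    have "absorbs_left K L (set_mset G) (set_mset D) (Disj A B)"
      using ldisj.hyps(1) ldisj.prems(1) by (auto simp: covers_def)
    then show ?case
    proof (rule absorbs_left_DisjE)
      assume "Disj A B \<in># G"
      then obtain G' where G: "G = add_mset (Disj A B) G'" by (metis multi_member_split)
      have "covers K L (add_mset E G') D (set_mset G) (set_mset D)" if "E \<in> {A, B}" for E
        using that by (auto simp: covers_def G intro: absorb)
      then have "covers K L (add_mset E G') D (insert E \<Gamma>) \<Delta>" if "E \<in> {A, B}" for E
        using that covers_trans[OF ldisj.prems(1)] by (auto simp: covers_insert_left intro: absorb)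
      then have "derivable L C (add_mset A G' \<turnstile> D)" "derivable L C (add_mset B G' \<turnstile> D)"
        using ldisj.IH(1)[of "add_mset A G'" D]
          ldisj.IH(2)[of "add_mset B G'" D] ldisj.prems(2)
        by (auto simp: G is_formula_def)
      moreover have "([add_mset A G' \<turnstile> D, add_mset B G' \<turnstile> D], G \<turnstile> D) \<in> LDisj"
        unfolding LDisj_def G by blast
      ultimately show ?thesis using ldisj.prems(2) by (auto intro: derivable_by2 rules)
    qed (use ldisj.IH ldisj.prems in \<open>auto simp: covers_insert_left\<close>)
  next
    case (rdisj A B \<Delta> \<Gamma>)
    have "absorbs_right K L (set_mset G) (set_mset D) (Disj A B)"
      using rdisj.hyps(1) rdisj.prems(1) by (auto simp: covers_def)
    then show ?case
    proof (rule absorbs_right_DisjE)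
      assume "Disj A B \<in># D"
      then obtain D' where D: "D = add_mset (Disj A B) D'" by (metis multi_member_split)
      let ?D = "add_mset A (add_mset B D')"
      have "covers K L G ?D (set_mset G) (set_mset D)"
        by (auto simp: covers_def D intro: absorb)
      then have "covers K L G ?D \<Gamma> (insert A (insert B \<Delta>))"
        using covers_trans[OF rdisj.prems(1)] by (auto simp: covers_insert_right intro: absorb)
      then have "derivable L C (G \<turnstile> ?D)"
        by (rule rdisj.IH) (use rdisj.prems(2) in \<open>auto simp: D is_formula_def\<close>)
      moreover have "([G \<turnstile> ?D], G \<turnstile> D) \<in> RDisj" unfolding RDisj_def D by blast
      ultimately show ?thesis using rdisj.prems(2) by (auto intro: derivable_by1 rules)
    qed (use rdisj.IH rdisj.prems in \<open>auto simp: covers_insert_right\<close>)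
  next
    case (limp A B \<Gamma> \<Delta>)
    have "absorbs_left K L (set_mset G) (set_mset D) (Imp A B)"
      using limp.hyps(1) limp.prems(1) by (auto simp: covers_def)
    then show ?case
    proof (rule absorbs_left_ImpE)
      assume "Imp A B \<in># G"
      then obtain G' where G: "G = add_mset (Imp A B) G'" by (metis multi_member_split)
      \<comment> \<open>The first premiss keeps the implication unless the logic is classical.\<close>
      let ?G = "if K = Classical then G' else G"
      have "covers K L ?G (add_mset A D) (set_mset G) (set_mset D)"
        "covers K L (add_mset B G') D (set_mset G) (set_mset D)"
        by (auto simp: covers_def G intro: absorb)
      then have "covers K L ?G (add_mset A D) \<Gamma> (insert A \<Delta>)"
        "covers K L (add_mset B G') D (insert B \<Gamma>) \<Delta>"
        using covers_trans[OF limp.prems(1)]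
        by (auto simp: covers_insert_left covers_insert_right intro: absorb)
      then have "derivable L C (?G \<turnstile> add_mset A D)" "derivable L C (add_mset B G' \<turnstile> D)"
        using limp.IH(1)[of ?G "add_mset A D"] limp.IH(2)[of "add_mset B G'" D] limp.prems(2)
        by (auto simp: G is_formula_def)
      moreover have "([G' \<turnstile> add_mset A D, add_mset B G' \<turnstile> D], G \<turnstile> D) \<in> LImp"
        unfolding LImp_def G by blast
      moreover have "([G \<turnstile> add_mset A D, add_mset B G' \<turnstile> D], G \<turnstile> D) \<in> LImp_i"
        unfolding LImp_i_def G by blast
      ultimately show ?thesis
        using limp.prems(2) by (cases "K = Classical") (auto intro: derivable_by2 rules)
    qed (use limp.IH limp.prems in \<open>auto simp: covers_insert_left covers_insert_right\<close>)
  next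
    case (rimp A B \<Delta> \<Gamma>)
    have "absorbs_right K L (set_mset G) (set_mset D) (Imp A B)"
      using rimp.hyps(1) rimp.prems(1) by (auto simp: covers_def)
    then show ?case
    proof (rule absorbs_right_ImpE)
      assume "Imp A B \<in># D"
      then obtain D' where D: "D = add_mset (Imp A B) D'" by (metis multi_member_split)
      show ?thesis
      proof (cases "K = Classical")
        case True
        have "covers K L (add_mset A G) (add_mset B D') (set_mset G) (set_mset D)"
          using True by (auto simp: covers_def D intro: absorb)
        then have "covers K L (add_mset A G) (add_mset B D') (insert A \<Gamma>) (insert B (side K \<Delta>))"
          using covers_trans[OF rimp.prems(1)]
          by (auto simp: classical[OF True] covers_insert_left covers_insert_right intro: absorb)
        then have "derivable L C (add_mset A G \<turnstile> add_mset B D')"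
          by (rule rimp.IH) (use rimp.prems(2) in \<open>auto simp: D is_formula_def\<close>)
        moreover have "([add_mset A G \<turnstile> add_mset B D'], G \<turnstile> D) \<in> RImp"
          unfolding RImp_def D by blast
        ultimately show ?thesis using True rimp.prems(2) by (auto intro: derivable_by1 rules)
      next
        case False
        have "covers K L (add_mset A G) {#B#} \<Gamma> {}"
          using False rimp.prems(1) by (auto elim: covers_left_nonclassical)
        then have "covers K L (add_mset A G) {#B#} (insert A \<Gamma>) (insert B (side K \<Delta>))"
          by (auto simp: nonclassical[OF False] covers_insert_left covers_insert_right intro: absorb)
        then have "derivable L C (add_mset A G \<turnstile> {#B#})"
          by (rule rimp.IH) (use rimp.prems(2) in \<open>auto simp: D is_formula_def\<close>)
        moreover have "([add_mset A G \<turnstile> {#B#}], G \<turnstile> D) \<in> RImp_i"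
          unfolding RImp_i_def D by blast
        ultimately show ?thesis using False rimp.prems(2) by (auto intro: derivable_by1 rules)
      qed
    next
      assume "K = Classical" "absorbs_left Classical L (set_mset G) (set_mset D) A"
        "absorbs_right Classical L (set_mset G) (set_mset D) B"
      then show ?thesis
        using rimp.IH[OF _ rimp.prems(2)] rimp.prems(1)
        by (simp add: side_def covers_insert_left covers_insert_right)
    qed
  next
    case (lall x A \<Gamma> t \<Delta>)
    have "absorbs_left K L (set_mset G) (set_mset D) (All x A)"
      using lall.hyps(1) lall.prems(1) by (auto simp: covers_def)
    then have "All x A \<in># G" by (auto elim: absorbs_left_AllE)
    then obtain G' where G: "G = add_mset (All x A) G'" by (metis multi_member_split)
    let ?A = "A\<langle>Bound x/t\<rangle>"
    have "covers K L (add_mset ?A G) D (set_mset G) (set_mset D)"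
      by (auto simp: covers_def intro: absorb)
    then have "covers K L (add_mset ?A G) D (insert ?A \<Gamma>) \<Delta>"
      using covers_trans[OF lall.prems(1)] by (auto simp: covers_insert_left intro: absorb)
    then have "derivable L C (add_mset ?A G \<turnstile> D)"
      by (rule lall.IH)
        (use lall.prems(2) lall.hyps(2) in \<open>auto simp: G is_formula_def intro: wf_subst_Bound\<close>)
    moreover have "([add_mset ?A G \<turnstile> D], G \<turnstile> D) \<in> LAll L"
      using lall.hyps(2) unfolding LAll_def G by blast
    ultimately show ?case using lall.prems(2) by (auto intro: derivable_by1 rules)
  next
    case (rall x A \<Delta> \<Gamma>)
    have "absorbs_right K L (set_mset G) (set_mset D) (All x A)"
      using rall.hyps(1) rall.prems(1) by (auto simp: covers_def)
    then show ?case
    proof (rule absorbs_right_AllE)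
      assume "All x A \<in># D"
      then obtain D' where D: "D = add_mset (All x A) D'" by (metis multi_member_split)
      obtain a where a: "Free a \<notin> seq_vars (G \<turnstile> D)" using fresh_for_sequent by blast
      have t: "is_term L (Var (Free a))" by (simp add: is_term_def)
      let ?A = "A\<langle>Bound x/Var (Free a)\<rangle>"
      have wf: "is_formula L ?A"
        using rall.prems(2) t by (auto simp: D is_formula_def intro: wf_subst_Bound)
      show ?thesis
      proof (cases "K = Classical")
        case True
        have "absorbs_right K L (set_mset G) (set_mset (add_mset ?A D')) (All x A)"
          using True t by (rule absorbs_left_absorbs_right.rall) (auto intro: absorb)
        then have "covers K L G (add_mset ?A D') (set_mset G) (set_mset D)"
          by (auto simp: covers_def D intro: absorb)
        then have "covers K L G (add_mset ?A D') \<Gamma> (insert ?A (side K \<Delta>))"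
          using covers_trans[OF rall.prems(1)]
          by (auto simp: classical[OF True] covers_insert_right intro: absorb)
        then have "derivable L C (G \<turnstile> add_mset ?A D')"
          by (rule rall.IH[OF t]) (use rall.prems(2) wf in \<open>auto simp: D\<close>)
        moreover have "([G \<turnstile> add_mset ?A D'], G \<turnstile> D) \<in> RAll"
          using a unfolding RAll_def D by blast
        ultimately show ?thesis using True rall.prems(2) by (auto intro: derivable_by1 rules)
      next
        case False
        have "covers K L G {#?A#} \<Gamma> {}"
          using False rall.prems(1) by (auto elim: covers_left_nonclassical)
        then have "covers K L G {#?A#} \<Gamma> (insert ?A (side K \<Delta>))"
          by (auto simp: nonclassical[OF False] covers_insert_right intro: absorb)
        then have "derivable L C (G \<turnstile> {#?A#})"
          by (rule rall.IH[OF t]) (use rall.prems(2) wf in \<open>auto simp: D\<close>)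
        moreover have "([G \<turnstile> {#?A#}], G \<turnstile> D) \<in> RAll_i"
          using a unfolding RAll_i_def D by blast
        ultimately show ?thesis using False rall.prems(2) by (auto intro: derivable_by1 rules)
      qed
    next
      fix t assume "K = Classical" "is_term L t"
        "absorbs_right Classical L (set_mset G) (set_mset D) (A\<langle>Bound x/t\<rangle>)"
      then show ?thesis
        using rall.IH[OF _ _ rall.prems(2)] rall.prems(1)
        by (simp add: side_def covers_insert_right)
    qed
  next
    case (lex x A \<Gamma> \<Delta>)
    have "absorbs_left K L (set_mset G) (set_mset D) (Ex x A)"
      using lex.hyps(1) lex.prems(1) by (auto simp: covers_def)
    then show ?case
    proof (rule absorbs_left_ExE)
      assume "Ex x A \<in># G"
      then obtain G' where G: "G = add_mset (Ex x A) G'" by (metis multi_member_split)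
      obtain a where a: "Free a \<notin> seq_vars (G \<turnstile> D)" using fresh_for_sequent by blast
      have t: "is_term L (Var (Free a))" by (simp add: is_term_def)
      let ?A = "A\<langle>Bound x/Var (Free a)\<rangle>"
      have wf: "is_formula L ?A"
        using lex.prems(2) t by (auto simp: G is_formula_def intro: wf_subst_Bound)
      have "absorbs_left K L (set_mset (add_mset ?A G')) (set_mset D) (Ex x A)"
        using t by (rule absorbs_left_absorbs_right.lex) (auto intro: absorb)
      then have "covers K L (add_mset ?A G') D (set_mset G) (set_mset D)"
        by (auto simp: covers_def G intro: absorb)
      then have "covers K L (add_mset ?A G') D (insert ?A \<Gamma>) \<Delta>"
        using covers_trans[OF lex.prems(1)] by (auto simp: covers_insert_left intro: absorb)
      then have "derivable L C (add_mset ?A G' \<turnstile> D)"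
        by (rule lex.IH[OF t]) (use lex.prems(2) wf in \<open>auto simp: G\<close>)
      moreover have "([add_mset ?A G' \<turnstile> D], G \<turnstile> D) \<in> LEx"
        using a unfolding LEx_def G by blast
      ultimately show ?thesis using lex.prems(2) by (auto intro: derivable_by1 rules)
    next
      fix t assume "is_term L t" "absorbs_left K L (set_mset G) (set_mset D) (A\<langle>Bound x/t\<rangle>)"
      then show ?thesis
        using lex.IH[OF _ _ lex.prems(2)] lex.prems(1) by (simp add: covers_insert_left)
    qed
  next
    case (rex x A \<Delta> t \<Gamma>)
    have "absorbs_right K L (set_mset G) (set_mset D) (Ex x A)"
      using rex.hyps(1) rex.prems(1) by (auto simp: covers_def)
    then have "Ex x A \<in># D" by (auto elim: absorbs_right_ExE)
    then obtain D' where D: "D = add_mset (Ex x A) D'" by (metis multi_member_split)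
    let ?A = "A\<langle>Bound x/t\<rangle>"
    let ?D = "add_mset (Ex x A) (add_mset ?A D')"
    have "covers K L G ?D (set_mset G) (set_mset D)"
      by (auto simp: covers_def D intro: absorb)
    then have "covers K L G ?D \<Gamma> (insert ?A \<Delta>)"
      using covers_trans[OF rex.prems(1)] by (auto simp: covers_insert_right intro: absorb)
    then have "derivable L C (G \<turnstile> ?D)"
      by (rule rex.IH)
        (use rex.prems(2) rex.hyps(2) in \<open>auto simp: D is_formula_def intro: wf_subst_Bound\<close>)
    moreover have "([G \<turnstile> ?D], G \<turnstile> D) \<in> REx L"
      using rex.hyps(2) unfolding REx_def D by blast
    ultimately show ?case using rex.prems(2) by (auto intro: derivable_by1 rules)
  }
qed

section \<open>Admissibility of the structural rules and equivalence\<close>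

lemma derivable_mono:
  assumes "derivable L C S" "C \<subseteq> C'"
  shows "derivable L C' S"
  using assms(1) by induction (use assms(2) in \<open>auto intro: derivable.intros\<close>)

lemma derivable_is_sequent: "derivable L C S \<Longrightarrow> is_sequent L S"
  by (erule derivable.cases) simp

text \<open>
  The right-hand side does not depend on the replacement rule, which gives the equivalences, and
  it does not count occurrences, which gives contraction.
\<close>

theorem derivable_iff_der:
  assumes "R \<in> {Rep, Rep1l, Rep2l}"
  shows "derivable L (calc K L \<union> {Ref, R}) (\<Gamma> \<turnstile> \<Delta>) \<longleftrightarrow>
    is_sequent L (\<Gamma> \<turnstile> \<Delta>) \<and> der K L (set_mset \<Gamma>) (set_mset \<Delta>)"
proof safe
  assume *: "derivable L (calc K L \<union> {Ref, R}) (\<Gamma> \<turnstile> \<Delta>)"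
  then show "is_sequent L (\<Gamma> \<turnstile> \<Delta>)" by (rule derivable_is_sequent)
  have "derivable L (calc K L \<union> {Ref, Rep, Rep1l, Rep2l}) (\<Gamma> \<turnstile> \<Delta>)"
    using * by (rule derivable_mono) (use assms in auto)
  then have "der_inst K L (\<lambda>a. Var (Free a)) (\<Gamma> \<turnstile> \<Delta>)"
    by (rule soundness) (simp add: is_term_def)
  then show "der K L (set_mset \<Gamma>) (set_mset \<Delta>)" by simp
next
  assume "der K L (set_mset \<Gamma>) (set_mset \<Delta>)" "is_sequent L (\<Gamma> \<turnstile> \<Delta>)"
  then show "derivable L (calc K L \<union> {Ref, R}) (\<Gamma> \<turnstile> \<Delta>)"
    using assms by (elim completeness)
      (auto simp: covers_def
        intro: absorbs_left_absorbs_right.left absorbs_left_absorbs_right.right)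
qed

lemma structural_rules_admissible:
  assumes "S \<in> structural_rules" "R \<in> {Rep, Rep1l, Rep2l}"
  shows "admissible L (calc K L \<union> {Ref, R}) S"
proof -
  define C where "C = calc K L \<union> {Ref, R}"
  note iff = derivable_iff_der[OF assms(2), of L K, folded C_def]
  have cut: "der K L (\<Gamma> \<union> \<Lambda>) (\<Delta> \<union> \<Theta>)"
    if "der K L \<Gamma> (insert A \<Delta>)" "der K L (insert A \<Lambda>) \<Theta>" for A \<Gamma> \<Delta> \<Lambda> \<Theta>
    by (rule cut[of K L _ A]) (use that in \<open>auto elim: weakening\<close>)
  show ?thesis
    using assms(1) unfolding structural_rules_def admissible_def C_def[symmetric]
    by (auto simp: LWeak_def RWeak_def LContr_def RContr_def Cut_def iff
        simp del: is_sequent.simps elim: weakening intro: cut)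
qed

theorem theorem20:
  fixes L :: "('f, 'p) lang" and G3 :: "('f, 'p) calculus"
  assumes "G3 \<in> {G3m L, G3i L, G3c L}"
  shows "(\<forall>R \<in> structural_rules. admissible L (G3 \<union> {Ref, Rep2l}) R)
       \<and> equivalent L (G3 \<union> {Ref, Rep}) (G3 \<union> {Ref, Rep2l})
       \<and> (\<forall>R \<in> structural_rules. admissible L (G3 \<union> {Ref, Rep1l}) R)
       \<and> equivalent L (G3 \<union> {Ref, Rep}) (G3 \<union> {Ref, Rep1l})"
proof -
  have "G3 \<in> {calc Minimal L, calc Intuitionistic L, calc Classical L}"
    using assms by (simp add: calc_def)
  then obtain K where "G3 = calc K L" by blast
  moreover have "equivalent L (calc K L \<union> {Ref, R}) (calc K L \<union> {Ref, R'})"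
    if "R \<in> {Rep, Rep1l, Rep2l}" "R' \<in> {Rep, Rep1l, Rep2l}" for R R'
    unfolding equivalent_def
    using derivable_iff_der[OF that(1), of L K] derivable_iff_der[OF that(2), of L K]
    by (metis sequent.exhaust)
  ultimately show ?thesis
    using structural_rules_admissible[of _ Rep2l L K] structural_rules_admissible[of _ Rep1l L K]
    by simp
qed

end
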